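(* Let $\mu$ be a $(2n+1)$-uniform measure on $\mathbb{H}^n$, and let $b\in\mathbb{R}^{2n}$, $\mathcal{T}\in\mathbb{R}$ and $\mathcal{Q}\in\mathrm{Sym}(2n)$ with $\mathrm{Tr}(\mathcal{Q})\neq0$ be such that $\mathrm{supp}(\mu)\subseteq\mathbb{K}(b,\mathcal{Q},\mathcal{T})$. Then the support of $\mu$ is the closure of a union of connected components of $\mathbb{K}(b,\mathcal{Q},\mathcal{T})\setminus\Sigma$, where $\Sigma$ is the set of those points where the tangent group to the surface $\mathbb{K}(b,\mathcal{Q},\mathcal{T})$ does not exist.
   Context: The Heisenberg group $\mathbb{H}^n$ is $\mathbb{R}^{2n}\times\mathbb{R}$, with points $x=(x_H,x_T)$ and product $x*y=(x_H+y_H,\,x_T+y_T+2\langle x_H,Jy_H\rangle)$, where $J=\begin{pmatrix}0&\mathrm{id}_n\\-\mathrm{id}_n&0\end{pmatrix}$. The anisotropic dilations are $D_\lambda(x)=(\lambda x_H,\lambda^2x_T)$ for $\lambda>0$. The Koranyi norm is $\|x\|=(|x_H|^4+|x_T|^2)^{1/4}$, the Koranyi distance is $d(x,y)=\|x^{-1}*y\|$, and $B_r(x)=\{z: d(z,x)\le r\}$. A Radon measure $\mu$ on $\mathbb{H}^n$ is $(2n+1)$-uniform if $0\in\mathrm{supp}(\mu)$ and $\mu(B_r(x))=r^{2n+1}$ for every $r>0$ and every $x\in\mathrm{supp}(\mu)$. $\mathrm{Sym}(2n)$ is the set of real symmetric $2n\times2n$ matrices, and $\mathbb{K}(b,\mathcal{Q},\mathcal{T}):=\{(x,t)\in\mathbb{R}^{2n}\times\mathbb{R}:\langle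 b,x\rangle+\langle x,\mathcal{Q}x\rangle+\mathcal{T}t=0\}$. For $\mathfrak{n}\in\mathbb{R}^{2n}\setminus\{0\}$ the vertical hyperplane $V(\mathfrak{n})=\{z\in\mathbb{H}^n:\langle\mathfrak{n},z_H\rangle=0\}$ is a homogeneous subgroup of $\mathbb{H}^n$ (a subgroup invariant under the dilations $D_\lambda$). The tangent group to $\mathbb{K}=\mathbb{K}(b,\mathcal{Q},\mathcal{T})$ at a point $z\in\mathbb{K}$ is the vertical hyperplane $V(\mathfrak{n})$, if there is one, to which the blow-ups $D_{1/r}(z^{-1}*\mathbb{K})$ converge, locally in the Hausdorff sense, as $r\to0$. *)

theory Defs
  imports "HOL-Analysis.Analysis"
begin

text \<open>
  The horizontal space of dimension \<open>2n\<close>, with \<open>n = CARD('n)\<close>, is indexed by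
  \<open>'n + 'n\<close>: the \<open>Inl\<close> coordinates are the first \<open>n\<close> ones and the \<open>Inr\<close> coordinates the
  last \<open>n\<close> ones.  For \<open>x\<close> in the group, \<open>x\<^sub>H = fst x\<close> and \<open>x\<^sub>T = snd x\<close>.
  The topology of this type is the Euclidean product topology, which is also the topology of
  the Koranyi distance, so \<open>open\<close>, \<open>closure\<close>, \<open>components\<close>, \<open>borel\<close> etc. are used as they are.
\<close>

type_synonym 'n horiz = "real ^ ('n + 'n)"
type_synonym 'n heis = "'n horiz \<times> real"

definition J_mat :: "real ^ ('n::finite + 'n) ^ ('n + 'n)" where
  "J_mat = (\<chi> i j. case (i, j) of
       (Inl k, Inr l) \<Rightarrow> if k = l then 1 else 0
     | (Inr k, Inl l) \<Rightarrow> if k = l then - 1 else 0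
     | _ \<Rightarrow> 0)"

definition heis_mult :: "'n::finite heis \<Rightarrow> 'n heis \<Rightarrow> 'n heis" where
  "heis_mult x y = (fst x + fst y, snd x + snd y + 2 * (fst x \<bullet> (J_mat *v fst y)))"

definition heis_inv :: "'n::finite heis \<Rightarrow> 'n heis" where
  "heis_inv x = (- fst x, - snd x)"

lemma inner_J_mat_self: "v \<bullet> (J_mat *v v) = 0" for v :: "'n::finite horiz"
proof -
  have "transpose J_mat = (- J_mat :: real ^ ('n + 'n) ^ ('n + 'n))"
    by (simp add: vec_eq_iff transpose_def J_mat_def split: sum.split)
  then have "v v* J_mat = - (J_mat *v v)"
    by (simp add: transpose_matrix_vector [symmetric] matrix_vector_mult_def vec_eq_iff sum_negf)
  then have "v \<bullet> (J_mat *v v) = - ((J_mat *v v) \<bullet> v)"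
    by (metis dot_lmul_matrix inner_minus_left)
  then show ?thesis by (simp add: inner_commute)
qed

lemma heis_mult_inv: "heis_mult x (heis_inv x) = 0" "heis_mult (heis_inv x) x = 0"
  using linear_neg [OF matrix_vector_mul_linear, of J_mat "fst x"]
  by (simp_all add: heis_mult_def heis_inv_def inner_J_mat_self zero_prod_def)

definition heis_dil :: "real \<Rightarrow> 'n::finite heis \<Rightarrow> 'n heis" where
  "heis_dil c x = (c *\<^sub>R fst x, c\<^sup>2 * snd x)"

definition koranyi_norm :: "'n::finite heis \<Rightarrow> real" where
  "koranyi_norm x = root 4 (norm (fst x) ^ 4 + \<bar>snd x\<bar>\<^sup>2)"

definition koranyi_dist :: "'n::finite heis \<Rightarrow> 'n heis \<Rightarrow> real" where
  "koranyi_dist x y = koranyi_norm (heis_mult (heis_inv x) y)"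

definition koranyi_ball :: "'n::finite heis \<Rightarrow> real \<Rightarrow> 'n heis set" where
  "koranyi_ball x r = {z. koranyi_dist z x \<le> r}"

definition radon_measure :: "'a::topological_space measure \<Rightarrow> bool" where
  "radon_measure \<mu> \<longleftrightarrow>
     sets \<mu> = sets borel \<and>
     (\<forall>K. compact K \<longrightarrow> emeasure \<mu> K < \<infinity>) \<and>
     (\<forall>U. open U \<longrightarrow> emeasure \<mu> U = (SUP K\<in>{K. compact K \<and> K \<subseteq> U}. emeasure \<mu> K)) \<and>
     (\<forall>A\<in>sets borel. emeasure \<mu> A = (INF U\<in>{U. open U \<and> A \<subseteq> U}. emeasure \<mu> U))"

definition msupport :: "'a::topological_space measure \<Rightarrow> 'a set" where
  "msupport \<mu> = {x. \<forall>U. open U \<and> x \<in> U \<longrightarrow> emeasure \<mu> U > 0}"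

definition codim1_uniform :: "'n::finite heis measure \<Rightarrow> bool" where
  "codim1_uniform \<mu> \<longleftrightarrow>
     radon_measure \<mu> \<and> 0 \<in> msupport \<mu> \<and>
     (\<forall>r>0. \<forall>x\<in>msupport \<mu>.
        emeasure \<mu> (koranyi_ball x r) = ennreal (r ^ (2 * CARD('n) + 1)))"

definition quadric ::
    "'n::finite horiz \<Rightarrow> real ^ ('n + 'n) ^ ('n + 'n) \<Rightarrow> real \<Rightarrow> 'n heis set" where
  "quadric b Q T = {(x, t). b \<bullet> x + x \<bullet> (Q *v x) + T * t = 0}"

definition vertical_hyperplane :: "'n::finite horiz \<Rightarrow> 'n heis set" where
  "vertical_hyperplane v = {z. v \<bullet> fst z = 0}"

text \<open>
  Hausdorff distance with respect to the Koranyi distance; it is extended-valued, so that no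
  nonemptiness or boundedness is needed for the suprema and infima to be meaningful.
\<close>

definition koranyi_excess :: "'n::finite heis set \<Rightarrow> 'n heis set \<Rightarrow> ennreal" where
  "koranyi_excess A B = (SUP a\<in>A. INF b\<in>B. ennreal (koranyi_dist a b))"

definition koranyi_hausdist :: "'n::finite heis set \<Rightarrow> 'n heis set \<Rightarrow> ennreal" where
  "koranyi_hausdist A B = max (koranyi_excess A B) (koranyi_excess B A)"

definition blowup :: "'n::finite heis set \<Rightarrow> 'n heis \<Rightarrow> real \<Rightarrow> 'n heis set" where
  "blowup S z r = heis_dil (1 / r) ` heis_mult (heis_inv z) ` S"

text \<open>
  Local Hausdorff convergence: the Hausdorff distance of the intersections with each closed ball
  centred at the origin tends to \<open>0\<close>.
\<close>

definition is_tangent_group :: "'n::finite heis set \<Rightarrow> 'n heis \<Rightarrow> 'n heis set \<Rightarrow> bool" where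
  "is_tangent_group S z W \<longleftrightarrow>
     z \<in> S \<and> (\<exists>v. v \<noteq> 0 \<and> W = vertical_hyperplane v) \<and>
     (\<forall>R>0. ((\<lambda>r. koranyi_hausdist (blowup S z r \<inter> koranyi_ball 0 R) (W \<inter> koranyi_ball 0 R))
               \<longlongrightarrow> 0) (at_right 0))"

definition singular_points :: "'n::finite heis set \<Rightarrow> 'n heis set" where
  "singular_points S = {z \<in> S. \<not> (\<exists>W. is_tangent_group S z W)}"

end

theory Submission
  imports Defs
begin

text \<open>
  Write \<open>f\<close> for the polynomial that defines the quadric \<open>K\<close> and \<open>c\<close> for its horizontal gradient, the
  vector of derivatives of \<open>f\<close> along the left-invariant horizontal fields; \<open>m = 2n + 1\<close>, where \<open>2n\<close> is
  the horizontal dimension.  Since \<open>f (x * y) = f x + c x \<bullet> y\<^sub>H + f\<^sub>0 y\<close> with \<open>f\<^sub>0\<close> homogeneous of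
  degree \<open>2\<close> under the dilations, the blow-ups of \<open>K\<close> at \<open>x\<close> flatten to the vertical hyperplane
  normal to \<open>c x\<close> if \<open>c x \<noteq> 0\<close>, and are all equal to the cone \<open>{f\<^sub>0 = 0}\<close> if \<open>c x = 0\<close>.  So the
  singular points are the characteristic points, where \<open>c\<close> vanishes
  (\<open>tangent_group_at_regular_point\<close>, \<open>tangent_group_at_characteristic_point\<close>).  The exception is a
  characteristic point whose cone \<open>{f\<^sub>0 = 0}\<close> is itself a vertical hyperplane; then, as \<open>0 \<in> K\<close>, \<open>K\<close> is
  that hyperplane, and it is defined by a linear equation as well, for which \<open>c\<close> never vanishes.

  The core is \<open>support_contains_neighbourhood\<close>: near a point of the support \<open>S\<close> with \<open>c \<noteq> 0\<close>, all of
  \<open>K\<close> belongs to \<open>S\<close>.  A natural surface measure \<open>\<sigma>\<close> on \<open>K\<close> satisfies \<open>\<sigma> (B\<^sub>r x) = (1 + o(1)) \<omega> r\<^sup>m\<close>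
  with one constant \<open>\<omega>\<close> near the point, because \<open>K\<close> is nearly flat there.  Integrating the indicator
  of \<open>d(x, y) \<le> r\<close> with respect to \<open>\<mu> \<times> \<sigma>\<close> over \<open>x\<close> in a ball \<open>B\<^sub>R\<close> centred on \<open>S\<close> in both orders, and
  letting \<open>r\<close> tend to \<open>0\<close>, shows that \<open>\<sigma> (S \<inter> B\<^sub>R)\<close> is at least \<open>(1 - o(1)) \<omega> R\<^sup>m\<close>: a point \<open>y\<close> of \<open>S\<close>
  sees at most \<open>\<mu>\<close>-mass \<open>r\<^sup>m\<close>, and a point outside the closed set \<open>S\<close> eventually sees none.  So \<open>S\<close> has almost full \<open>\<sigma>\<close>-measure in
  every small ball centred on it.  If a point of \<open>K\<close> at distance \<open>d\<close> from \<open>S\<close> existed nearby, a ball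
  of radius \<open>3 d\<close> centred on \<open>S\<close> would contain a ball of radius \<open>d / 2\<close> centred on \<open>K\<close> and free of
  \<open>S\<close>, which has a fixed fraction of its \<open>\<sigma>\<close>-measure.

  Instead of constructing \<open>\<sigma>\<close>, the proof uses the Lebesgue measure of \<open>{\<bar>f\<bar> < \<delta>}\<close> with one tiny \<open>\<delta>\<close>;
  the required estimate is \<open>quadric_ball_measure\<close>.  Passing to the limit \<open>r \<rightarrow> 0\<close> is replaced by a
  pigeonhole argument over finitely many scales, as the troublesome points, those at distance
  comparable to \<open>r\<close> from \<open>S\<close>, form disjoint sets for different scales.

  The same double integral, with Lebesgue measure in place of \<open>\<sigma>\<close>, shows that \<open>S\<close> cannot consist of
  characteristic points in any ball \<open>B\<^sub>\<rho> p\<close> with \<open>p \<in> S\<close> (\<open>support_not_characteristic\<close>): the \<open>r\<close>-neighbourhood of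
  \<open>S \<inter> B\<^sub>\<rho> p\<close> has volume at least of order \<open>r\<close>, but the \<open>r\<close>-neighbourhood of the characteristic
  points in the ball has volume of order \<open>r\<^sup>2\<close>.  If \<open>T = 0\<close>, this depends on \<open>Q \<noteq> 0\<close>, which the
  trace condition provides, and on the absence of the exceptional case.  Hence the regular points of \<open>S\<close> are dense in \<open>S\<close>, and they form a set
  that is open and closed relative to \<open>K - \<Sigma>\<close>, that is, a union of components.
\<close>

section \<open>The group, its norm and its topology\<close>

lemma J_mat_mult_Inl: "(J_mat *v (y::'n::finite horiz)) $ Inl k = y $ Inr k"
  and J_mat_mult_Inr: "(J_mat *v y) $ Inr k = - (y $ Inl k)"
  by (simp_all add: matrix_vector_mult_def J_mat_def UNIV_Plus_UNIV [symmetric] sum.Plus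
      if_distrib [of "\<lambda>x. x * _"] sum.delta sum_negf del: UNIV_Plus_UNIV cong: if_cong)

lemma norm_J_mat: "norm (J_mat *v (y::'n::finite horiz)) = norm y"
  by (simp add: norm_eq_sqrt_inner inner_vec_def UNIV_Plus_UNIV [symmetric] sum.Plus
      J_mat_mult_Inl J_mat_mult_Inr add.commute del: UNIV_Plus_UNIV)

lemma inner_J_mat_swap: "x \<bullet> (J_mat *v y) = - (y \<bullet> (J_mat *v x))" for x y :: "'n::finite horiz"
proof -
  have "(x + y) \<bullet> (J_mat *v (x + y)) = 0" by (rule inner_J_mat_self)
  then show ?thesis
    using inner_J_mat_self[of x] inner_J_mat_self[of y]
    by (simp add: matrix_vector_right_distrib inner_simps)
qed

lemma J_mat_scaleR: "J_mat *v (c *\<^sub>R y) = c *\<^sub>R (J_mat *v (y::'n::finite horiz))"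
  by (simp add: linear_cmul[OF matrix_vector_mul_linear])

lemma J_mat_minus: "J_mat *v (- y) = - (J_mat *v (y::'n::finite horiz))"
  by (simp add: linear_neg[OF matrix_vector_mul_linear])

lemma mat_diff: "M *v (x - y) = M *v x - M *v (y::real^'a::finite)" for M :: "real^'a^'b::finite"
  by (simp add: linear_diff[OF matrix_vector_mul_linear])

lemma mat_scaleR: "M *v (c *\<^sub>R x) = c *\<^sub>R (M *v (x::real^'a::finite))" for M :: "real^'a^'b::finite"
  by (simp add: linear_cmul[OF matrix_vector_mul_linear])

lemma continuous_on_mat [continuous_intros]:
  "continuous_on A f \<Longrightarrow> continuous_on A (\<lambda>x. M *v (f x))" for M :: "real^'a::finite^'b::finite"
  by (rule bounded_linear.continuous_on[OF matrix_vector_mul_bounded_linear])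

lemma heis_assoc: "heis_mult (heis_mult x y) z = heis_mult x (heis_mult y z)"
  by (simp add: heis_mult_def matrix_vector_right_distrib inner_simps algebra_simps)

lemma heis_zero [simp]: "heis_mult 0 x = x" "heis_mult x 0 = x"
  by (simp_all add: heis_mult_def zero_prod_def)

lemma heis_cancel [simp]: "heis_mult (heis_inv x) (heis_mult x y) = y"
  "heis_mult x (heis_mult (heis_inv x) y) = y"
  by (simp_all add: heis_assoc[symmetric] heis_mult_inv)

lemma heis_inv_mult: "heis_inv (heis_mult x y) = heis_mult (heis_inv y) (heis_inv x)"
  by (simp add: heis_inv_def heis_mult_def J_mat_minus inner_J_mat_swap[of "fst x"])

lemma heis_inv_inv [simp]: "heis_inv (heis_inv x) = x"
  by (simp add: heis_inv_def)

lemma heis_dil_dil [simp]: "heis_dil c (heis_dil d x) = heis_dil (c * d) x"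
  by (simp add: heis_dil_def power_mult_distrib)

lemma heis_dil_1 [simp]: "heis_dil 1 x = x"
  by (simp add: heis_dil_def)

lemma koranyi_norm_nonneg [simp]: "0 \<le> koranyi_norm x"
  by (simp add: koranyi_norm_def)

lemma koranyi_norm_pow4: "koranyi_norm x ^ 4 = norm (fst x) ^ 4 + (snd x)\<^sup>2"
  unfolding koranyi_norm_def by (subst real_root_pow_pos2) auto

lemma koranyi_norm_zero [simp]: "koranyi_norm 0 = 0"
  by (simp add: koranyi_norm_def)

lemma koranyi_norm_inv [simp]: "koranyi_norm (heis_inv x) = koranyi_norm x"
  by (simp add: koranyi_norm_def heis_inv_def)

lemma koranyi_norm_dil: "c \<ge> 0 \<Longrightarrow> koranyi_norm (heis_dil c x) = c * koranyi_norm x"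
proof -
  assume c: "c \<ge> 0"
  have "koranyi_norm (heis_dil c x) ^ 4 = (c * koranyi_norm x) ^ 4"
    using c by (simp add: koranyi_norm_pow4 power_mult_distrib heis_dil_def algebra_simps flip: power_mult)
  then show ?thesis
    using c by (simp add: power_eq_iff_eq_base)
qed

lemma norm_fst_le_koranyi: "norm (fst x) \<le> koranyi_norm x"
proof -
  have "norm (fst x) ^ 4 \<le> koranyi_norm x ^ 4" by (simp add: koranyi_norm_pow4)
  then show ?thesis by (simp add: power_mono_iff)
qed

lemma abs_snd_le_koranyi: "\<bar>snd x\<bar> \<le> (koranyi_norm x)\<^sup>2"
proof -
  have "\<bar>snd x\<bar>\<^sup>2 \<le> ((koranyi_norm x)\<^sup>2)\<^sup>2" by (simp add: koranyi_norm_pow4 flip: power_mult)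
  then show ?thesis by (rule power2_le_imp_le) simp
qed

text \<open>
  Identify \<open>x\<close> with the complex number \<open>|x\<^sub>H|\<^sup>2 + \<i> x\<^sub>T\<close>, whose modulus is the square of the
  Koranyi norm.  The number of a product is the sum of the numbers of the factors and twice the
  Hermitian product of the horizontal parts, whose modulus obeys the Cauchy--Schwarz inequality.
\<close>

lemma koranyi_norm_triangle: "koranyi_norm (heis_mult x y) \<le> koranyi_norm x + koranyi_norm y"
proof -
  define Z where "Z w = Complex ((norm (fst w))\<^sup>2) (snd w)" for w :: "'a heis"
  have Z: "cmod (Z w) = (koranyi_norm w)\<^sup>2" for w :: "'a heis"
  proof -
    have "(cmod (Z w))\<^sup>2 = ((koranyi_norm w)\<^sup>2)\<^sup>2"
      by (simp add: Z_def cmod_power2 koranyi_norm_pow4 flip: power_mult)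
    then show ?thesis by (rule power2_eq_imp_eq) simp_all
  qed
  define a where "a = fst x"
  define u where "u = fst y"
  define p where "p = Complex (a \<bullet> u) (a \<bullet> (J_mat *v u))"
  have sum: "Z (heis_mult x y) = Z x + Z y + 2 * p"
    by (simp add: Z_def heis_mult_def p_def a_def u_def complex_eq_iff power2_norm_eq_inner
        inner_simps inner_commute)
  have p: "cmod p \<le> norm a * norm u"
  proof (cases "u = 0")
    case True
    then show ?thesis by (simp add: p_def complex_eq_iff)
  next
    case False
    define v where "v = (a \<bullet> u) *\<^sub>R u + (a \<bullet> (J_mat *v u)) *\<^sub>R (J_mat *v u)"
    have Ju: "(J_mat *v u) \<bullet> (J_mat *v u) = u \<bullet> u"
      using norm_J_mat[of u] by (simp add: norm_eq_sqrt_inner)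
    have uJu: "u \<bullet> (J_mat *v u) = 0" "(J_mat *v u) \<bullet> u = 0"
      using inner_J_mat_self[of u] by (simp_all add: inner_commute)
    have pp: "(cmod p)\<^sup>2 = (a \<bullet> u)\<^sup>2 + (a \<bullet> (J_mat *v u))\<^sup>2"
      by (simp add: p_def cmod_power2)
    have vv: "v \<bullet> v = (cmod p)\<^sup>2 * (u \<bullet> u)"
      unfolding v_def pp inner_add_left inner_add_right inner_scaleR_left inner_scaleR_right Ju uJu
      by (simp add: power2_eq_square distrib_right)
    have av: "a \<bullet> v = (cmod p)\<^sup>2"
      unfolding v_def pp inner_add_right inner_scaleR_right by (simp add: power2_eq_square)
    have "(cmod p)\<^sup>2 \<le> norm a * norm v"
      using Cauchy_Schwarz_ineq2[of a v] av by simp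
    also have "norm v = cmod p * norm u"
      by (simp add: norm_eq_sqrt_inner[of v] vv real_sqrt_mult norm_eq_sqrt_inner[of u])
    finally have "cmod p * cmod p \<le> cmod p * (norm a * norm u)"
      by (simp add: power2_eq_square ac_simps)
    then show ?thesis
      by (cases "cmod p = 0") (auto simp: mult_le_cancel_left_pos)
  qed
  have "(koranyi_norm (heis_mult x y))\<^sup>2 \<le> cmod (Z x) + cmod (Z y) + 2 * cmod p"
    unfolding Z[symmetric] sum
    by (metis (no_types, lifting) add_mono_thms_linordered_semiring(3) norm_mult norm_numeral
        norm_triangle_ineq order_trans)
  also have "cmod p \<le> koranyi_norm x * koranyi_norm y"
    using p norm_fst_le_koranyi[of x] norm_fst_le_koranyi[of y]
    by (smt (verit) a_def u_def koranyi_norm_nonneg mult_mono norm_ge_zero)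
  finally have "(koranyi_norm (heis_mult x y))\<^sup>2 \<le> (koranyi_norm x + koranyi_norm y)\<^sup>2"
    by (simp add: Z power2_sum)
  then show ?thesis
    by (rule power2_le_imp_le) simp
qed

lemma koranyi_dist_sym: "koranyi_dist x y = koranyi_dist y x"
proof -
  have "heis_inv (heis_mult (heis_inv x) y) = heis_mult (heis_inv y) x"
    by (simp only: heis_inv_mult heis_inv_inv)
  then show ?thesis unfolding koranyi_dist_def by (metis koranyi_norm_inv)
qed

lemma koranyi_dist_triangle: "koranyi_dist x z \<le> koranyi_dist x y + koranyi_dist y z"
proof -
  have "heis_mult (heis_mult (heis_inv x) y) (heis_mult (heis_inv y) z) = heis_mult (heis_inv x) z"
    by (simp only: heis_assoc heis_cancel)
  then show ?thesis unfolding koranyi_dist_def by (metis koranyi_norm_triangle)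
qed

lemma koranyi_dist_self [simp]: "koranyi_dist x x = 0"
  by (simp add: koranyi_dist_def heis_mult_inv)

lemma koranyi_dist_nonneg [simp]: "0 \<le> koranyi_dist x y"
  by (simp add: koranyi_dist_def)

lemma koranyi_dist_0 [simp]: "koranyi_dist 0 x = koranyi_norm x" "koranyi_dist x 0 = koranyi_norm x"
proof -
  have "heis_inv 0 = (0 :: 'a heis)" by (simp add: heis_inv_def zero_prod_def)
  then show "koranyi_dist 0 x = koranyi_norm x" by (simp add: koranyi_dist_def)
  then show "koranyi_dist x 0 = koranyi_norm x" by (metis koranyi_dist_sym)
qed

lemma koranyi_dist_mult: "koranyi_dist x (heis_mult x u) = koranyi_norm u"
  by (simp add: koranyi_dist_def)

lemma mem_koranyi_ball: "z \<in> koranyi_ball x r \<longleftrightarrow> koranyi_dist x z \<le> r"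
  by (simp add: koranyi_ball_def koranyi_dist_sym[of z x])

lemma continuous_on_heis_mult [continuous_intros]:
  "continuous_on A f \<Longrightarrow> continuous_on A g \<Longrightarrow> continuous_on A (\<lambda>x. heis_mult (f x) (g x))"
  unfolding heis_mult_def by (intro continuous_intros)

lemma continuous_on_heis_inv [continuous_intros]:
  "continuous_on A f \<Longrightarrow> continuous_on A (\<lambda>x. heis_inv (f x))"
  unfolding heis_inv_def by (intro continuous_intros)

lemma continuous_on_heis_dil [continuous_intros]:
  "continuous_on A c \<Longrightarrow> continuous_on A f \<Longrightarrow> continuous_on A (\<lambda>x. heis_dil (c x) (f x))"
  unfolding heis_dil_def by (intro continuous_intros)

lemma continuous_on_koranyi_norm [continuous_intros]:
  "continuous_on A f \<Longrightarrow> continuous_on A (\<lambda>x. koranyi_norm (f x))"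
  unfolding koranyi_norm_def by (intro continuous_intros)

lemma continuous_on_koranyi_dist [continuous_intros]:
  "continuous_on A f \<Longrightarrow> continuous_on A g \<Longrightarrow> continuous_on A (\<lambda>x. koranyi_dist (f x) (g x))"
  unfolding koranyi_dist_def by (intro continuous_intros)

text \<open>
  Together with the continuity of the Koranyi distance this says that it induces the Euclidean
  topology.
\<close>

lemma koranyi_ball_open_nbhd:
  assumes "open U" "y \<in> U"
  shows "\<exists>\<epsilon>>0. \<forall>x. koranyi_dist y x < \<epsilon> \<longrightarrow> x \<in> U"
proof -
  have "continuous_on UNIV (heis_mult y)" by (intro continuous_intros)
  then have "open (heis_mult y -` U)" by (rule open_vimage[OF assms(1)])
  moreover have "0 \<in> heis_mult y -` U" using assms by simp
  ultimately obtain d where d: "d > 0" "ball 0 d \<subseteq> heis_mult y -` U"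
    using open_contains_ball by metis
  define e where "e = min 1 (d / 2)"
  have "x \<in> U" if "koranyi_dist y x < e" for x
  proof -
    define u where "u = heis_mult (heis_inv y) x"
    have u: "koranyi_norm u < e" using that by (simp add: koranyi_dist_def u_def)
    have "norm u \<le> norm (fst u) + \<bar>snd u\<bar>" by (metis norm_Pair_le prod.collapse real_norm_def)
    also have "\<dots> \<le> koranyi_norm u + (koranyi_norm u)\<^sup>2"
      by (intro add_mono norm_fst_le_koranyi abs_snd_le_koranyi)
    also have "(koranyi_norm u)\<^sup>2 \<le> koranyi_norm u"
      using u by (simp add: e_def power2_eq_square mult_left_le)
    also have "koranyi_norm u + koranyi_norm u < d"
      using u by (simp add: e_def)
    finally have "u \<in> ball 0 d" by simp
    then have "heis_mult y u \<in> U" using d by auto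
    then show ?thesis by (simp add: u_def)
  qed
  moreover have "e > 0" using d by (simp add: e_def)
  ultimately show ?thesis by blast
qed

lemma open_koranyi: "open {x. koranyi_dist y x < r}"
  by (rule open_Collect_less) (intro continuous_intros)+

lemma closed_koranyi_ball: "closed (koranyi_ball y r)"
proof -
  have "koranyi_ball y r = {x. koranyi_dist x y \<le> r}" by (simp add: koranyi_ball_def)
  then show ?thesis
    by (simp add: closed_Collect_le continuous_on_koranyi_dist)
qed

lemma koranyi_norm_bounded: "koranyi_norm u \<le> r \<Longrightarrow> norm u \<le> r + r\<^sup>2"
proof -
  assume r: "koranyi_norm u \<le> r"
  have "norm u \<le> norm (fst u) + \<bar>snd u\<bar>" by (metis norm_Pair_le prod.collapse real_norm_def)
  also have "\<dots> \<le> koranyi_norm u + (koranyi_norm u)\<^sup>2"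
    by (intro add_mono norm_fst_le_koranyi abs_snd_le_koranyi)
  also have "\<dots> \<le> r + r\<^sup>2"
    using r by (intro add_mono power_mono) auto
  finally show ?thesis .
qed

lemma compact_koranyi_ball: "compact (koranyi_ball y r)"
proof -
  have "koranyi_ball y r = heis_mult y ` koranyi_ball 0 r"
  proof (intro equalityI subsetI)
    fix x assume "x \<in> koranyi_ball y r"
    then have "heis_mult (heis_inv y) x \<in> koranyi_ball 0 r"
      unfolding mem_koranyi_ball koranyi_dist_0 unfolding koranyi_dist_def .
    then show "x \<in> heis_mult y ` koranyi_ball 0 r" by (metis heis_cancel(2) imageI)
  qed (auto simp: mem_koranyi_ball koranyi_dist_mult)
  moreover have "compact (koranyi_ball 0 r)"
  proof -
    have "bounded (koranyi_ball 0 r)"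
      unfolding bounded_iff
      by (metis mem_koranyi_ball koranyi_dist_0(1) koranyi_norm_bounded)
    then show ?thesis by (simp add: compact_eq_bounded_closed closed_koranyi_ball)
  qed
  moreover have "continuous_on (koranyi_ball 0 r) (heis_mult y)" by (intro continuous_intros)
  ultimately show ?thesis by (metis compact_continuous_image)
qed

section \<open>Volume, dilations and slices along a direction\<close>

lemma nn_integral_lborel_affine:
  fixes F :: "'a::euclidean_space \<Rightarrow> ennreal"
  assumes [measurable]: "F \<in> borel_measurable borel" and r: "r > (0::real)"
  shows "(\<integral>\<^sup>+z. F z \<partial>lborel) = ennreal (r ^ DIM('a)) * (\<integral>\<^sup>+u. F (t + r *\<^sub>R u) \<partial>lborel)"
proof -
  have "(\<integral>\<^sup>+z. F z \<partial>lborel)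
      = (\<integral>\<^sup>+z. F z \<partial>density (distr lborel borel (\<lambda>u. t + r *\<^sub>R u)) (\<lambda>_. ennreal (\<bar>r\<bar> ^ DIM('a))))"
    using lborel_affine[of r t] r by simp
  also have "\<dots> = (\<integral>\<^sup>+u. ennreal (r ^ DIM('a)) * F (t + r *\<^sub>R u) \<partial>lborel)"
    using r by (simp add: nn_integral_density nn_integral_distr)
  also have "\<dots> = ennreal (r ^ DIM('a)) * (\<integral>\<^sup>+u. F (t + r *\<^sub>R u) \<partial>lborel)"
    by (rule nn_integral_cmult) simp
  finally show ?thesis .
qed

lemma measurable_heis [measurable]:
  "heis_mult x \<in> borel_measurable borel" "heis_inv \<in> borel_measurable borel"
  "heis_dil c \<in> borel_measurable borel" "koranyi_norm \<in> borel_measurable borel"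
  "koranyi_dist x \<in> borel_measurable borel"
  by (intro borel_measurable_continuous_onI continuous_intros)+

text \<open>
  Left translations are shears over the horizontal translations, so that they preserve the volume.
\<close>

lemma nn_integral_heis:
  fixes F :: "'n::finite heis \<Rightarrow> ennreal"
  assumes [measurable]: "F \<in> borel_measurable borel" and r: "r > 0"
  shows "(\<integral>\<^sup>+z. F z \<partial>lborel)
    = ennreal (r ^ (2 * CARD('n) + 2)) * (\<integral>\<^sup>+u. F (heis_mult x (heis_dil r u)) \<partial>lborel)"
proof -
  have F [measurable]: "F \<in> borel_measurable (lborel \<Otimes>\<^sub>M lborel)"
    by (simp add: lborel_prod)
  have shear: "(\<lambda>u. F (heis_mult x (heis_dil r u))) \<in> borel_measurable (lborel \<Otimes>\<^sub>M lborel)"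
    unfolding lborel_prod by simp
  have "(\<integral>\<^sup>+z. F z \<partial>lborel) = (\<integral>\<^sup>+h. \<integral>\<^sup>+t. F (h, t) \<partial>lborel \<partial>lborel)"
    unfolding lborel_prod[symmetric] by (rule lborel.nn_integral_fst[symmetric]) simp
  also have "\<dots> = ennreal (r ^ (2 * CARD('n))) *
      (\<integral>\<^sup>+h. \<integral>\<^sup>+t. F (fst x + r *\<^sub>R h, t) \<partial>lborel \<partial>lborel)"
    by (subst nn_integral_lborel_affine[where r=r and t="fst x"]) (use r in \<open>simp_all add: mult_2\<close>)
  also have "(\<integral>\<^sup>+h. \<integral>\<^sup>+t. F (fst x + r *\<^sub>R h, t) \<partial>lborel \<partial>lborel)
    = (\<integral>\<^sup>+h. ennreal (r\<^sup>2) * (\<integral>\<^sup>+t. F (heis_mult x (heis_dil r (h, t))) \<partial>lborel) \<partial>lborel)"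
  proof (rule nn_integral_cong)
    fix h :: "'n horiz"
    have "(\<integral>\<^sup>+t. F (fst x + r *\<^sub>R h, t) \<partial>lborel)
        = ennreal ((r\<^sup>2) ^ DIM(real)) * (\<integral>\<^sup>+t. F (fst x + r *\<^sub>R h,
            (snd x + 2 * (fst x \<bullet> (J_mat *v (r *\<^sub>R h)))) + r\<^sup>2 *\<^sub>R t) \<partial>lborel)"
      by (rule nn_integral_lborel_affine) (use r in simp_all)
    then show "(\<integral>\<^sup>+t. F (fst x + r *\<^sub>R h, t) \<partial>lborel)
        = ennreal (r\<^sup>2) * (\<integral>\<^sup>+t. F (heis_mult x (heis_dil r (h, t))) \<partial>lborel)"
      by (simp add: heis_mult_def heis_dil_def algebra_simps)
  qed
  also have "\<dots> = ennreal (r\<^sup>2) * (\<integral>\<^sup>+h. \<integral>\<^sup>+t. F (heis_mult x (heis_dil r (h, t))) \<partial>lborel \<partial>lborel)"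
    by (rule nn_integral_cmult, rule lborel.borel_measurable_nn_integral_fst[OF shear])
  also have "(\<integral>\<^sup>+h. \<integral>\<^sup>+t. F (heis_mult x (heis_dil r (h, t))) \<partial>lborel \<partial>lborel)
      = (\<integral>\<^sup>+u. F (heis_mult x (heis_dil r u)) \<partial>lborel)"
    unfolding lborel_prod[symmetric] by (rule lborel.nn_integral_fst[OF shear])
  finally have "(\<integral>\<^sup>+z. F z \<partial>lborel) = ennreal (r ^ (2 * CARD('n))) *
      (ennreal (r\<^sup>2) * (\<integral>\<^sup>+u. F (heis_mult x (heis_dil r u)) \<partial>lborel))" .
  moreover have "ennreal (r ^ (2 * CARD('n) + 2)) = ennreal (r ^ (2 * CARD('n))) * ennreal (r\<^sup>2)"
    unfolding power_add by (rule ennreal_mult) (use r in simp_all)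
  ultimately show ?thesis by (simp only: mult.assoc)
qed

lemma emeasure_heis:
  fixes E :: "'n::finite heis set"
  assumes [measurable]: "E \<in> sets borel" and r: "r > 0"
  shows "emeasure lborel E
    = ennreal (r ^ (2 * CARD('n) + 2)) * emeasure lborel {u. heis_mult x (heis_dil r u) \<in> E}"
proof -
  have [measurable]: "{u. heis_mult x (heis_dil r u) \<in> E} \<in> sets borel" by measurable
  have "emeasure lborel E = (\<integral>\<^sup>+z. indicator E z \<partial>lborel)" by simp
  also have "\<dots> = ennreal (r ^ (2 * CARD('n) + 2)) * (\<integral>\<^sup>+u. indicator E (heis_mult x (heis_dil r u)) \<partial>lborel)"
    by (rule nn_integral_heis) (use r in simp_all)
  also have "(\<integral>\<^sup>+u. indicator E (heis_mult x (heis_dil r u)) \<partial>lborel)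
      = (\<integral>\<^sup>+u. indicator {u. heis_mult x (heis_dil r u) \<in> E} u \<partial>lborel)"
    by (rule nn_integral_cong) (simp add: indicator_def)
  finally show ?thesis by simp
qed

text \<open>
  Each line in the direction \<open>e\<close> crosses the slab \<open>0 \<le> l < 1\<close> in a segment of length \<open>1\<close>, and it is
  counted once by integrating over its points in that slab.  This is Fubini's theorem along \<open>e\<close>
  without a choice of coordinates.
\<close>

lemma emeasure_by_slices:
  fixes l :: "'a::euclidean_space \<Rightarrow> real"
  assumes l: "bounded_linear l" and e: "l e = 1" and [measurable]: "E \<in> sets borel"
  shows "emeasure lborel E =
    (\<integral>\<^sup>+w. indicator {w. 0 \<le> l w \<and> l w < 1} w * emeasure lborel {s. w + s *\<^sub>R e \<in> E} \<partial>lborel)"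
proof -
  interpret l: bounded_linear l by fact
  have [measurable]: "l \<in> borel_measurable borel"
    using l.continuous_on[OF continuous_on_id] by (rule borel_measurable_continuous_onI)
  let ?S = "{w. 0 \<le> l w \<and> l w < 1}"
  have "(\<integral>\<^sup>+w. indicator ?S w * emeasure lborel {s. w + s *\<^sub>R e \<in> E} \<partial>lborel)
      = (\<integral>\<^sup>+w. \<integral>\<^sup>+s. indicator ?S w * indicator E (w + s *\<^sub>R e) \<partial>lborel \<partial>lborel)"
  proof (rule nn_integral_cong)
    fix w
    have "emeasure lborel {s. w + s *\<^sub>R e \<in> E} = (\<integral>\<^sup>+s. indicator {s. w + s *\<^sub>R e \<in> E} s \<partial>lborel)"
      by simp
    also have "\<dots> = (\<integral>\<^sup>+s. indicator E (w + s *\<^sub>R e) \<partial>lborel)"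
      by (rule nn_integral_cong) (simp add: indicator_def)
    finally show "indicator ?S w * emeasure lborel {s. w + s *\<^sub>R e \<in> E}
        = (\<integral>\<^sup>+s. indicator ?S w * indicator E (w + s *\<^sub>R e) \<partial>lborel)"
      by (simp add: nn_integral_cmult)
  qed
  also have "\<dots> = (\<integral>\<^sup>+s. \<integral>\<^sup>+w. indicator ?S w * indicator E (w + s *\<^sub>R e) \<partial>lborel \<partial>lborel)"
    by (rule lborel_pair.Fubini') simp
  also have "\<dots> = (\<integral>\<^sup>+s. \<integral>\<^sup>+w. indicator ?S (w - s *\<^sub>R e) * indicator E w \<partial>lborel \<partial>lborel)"
  proof (rule nn_integral_cong)
    fix s
    show "(\<integral>\<^sup>+w. indicator ?S w * indicator E (w + s *\<^sub>R e) \<partial>lborel)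
        = (\<integral>\<^sup>+w. indicator ?S (w - s *\<^sub>R e) * indicator E w \<partial>lborel)"
      by (subst nn_integral_lborel_affine[where r=1 and t="- (s *\<^sub>R e)"]) simp_all
  qed
  also have "\<dots> = (\<integral>\<^sup>+w. \<integral>\<^sup>+s. indicator ?S (w - s *\<^sub>R e) * indicator E w \<partial>lborel \<partial>lborel)"
    by (rule lborel_pair.Fubini') simp
  also have "\<dots> = (\<integral>\<^sup>+w. indicator E w \<partial>lborel)"
  proof (rule nn_integral_cong)
    fix w
    have "(\<integral>\<^sup>+s. indicator ?S (w - s *\<^sub>R e) * indicator E w \<partial>lborel)
        = (\<integral>\<^sup>+s. indicator {l w - 1<..l w} s * indicator E w \<partial>lborel)"
      by (rule nn_integral_cong) (auto simp: indicator_def l.diff l.scaleR e)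
    also have "\<dots> = indicator E w"
      by (simp add: nn_integral_multc)
    finally show "(\<integral>\<^sup>+s. indicator ?S (w - s *\<^sub>R e) * indicator E w \<partial>lborel) = indicator E w" .
  qed
  finally show ?thesis by simp
qed

lemma emeasure_diameter_le:
  fixes X :: "real set"
  assumes "\<And>s s'. s \<in> X \<Longrightarrow> s' \<in> X \<Longrightarrow> \<bar>s - s'\<bar> \<le> D"
  shows "emeasure lborel X \<le> ennreal D"
proof (cases "X = {}")
  case False
  then obtain s0 where s0: "s0 \<in> X" by auto
  then have D: "D \<ge> 0" using assms[of s0 s0] by simp
  have bb: "bdd_below X" using assms[OF s0] by (intro bdd_belowI[of _ "s0 - D"]) (smt (verit))
  have "X \<subseteq> {Inf X..Inf X + D}"
  proof
    fix s assume s: "s \<in> X"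
    have "s - D \<le> Inf X" by (rule cInf_greatest[OF False]) (use assms[OF s] in \<open>smt (verit)\<close>)
    then show "s \<in> {Inf X..Inf X + D}" using cInf_lower[OF s bb] by simp
  qed
  then have "emeasure lborel X \<le> emeasure lborel {Inf X..Inf X + D}"
    by (rule emeasure_mono) simp
  then show ?thesis using D by simp
qed simp

lemma emeasure_slices_le:
  fixes l :: "'a::euclidean_space \<Rightarrow> real"
  assumes l: "bounded_linear l" and e: "l e = 1"
    and [measurable]: "E \<in> sets borel" "F \<in> sets borel"
    and D: "\<And>w s s'. w + s *\<^sub>R e \<in> E \<Longrightarrow> w + s' *\<^sub>R e \<in> E \<Longrightarrow> \<bar>s - s'\<bar> \<le> D"
    and F: "\<And>w s. 0 \<le> l w \<Longrightarrow> l w < 1 \<Longrightarrow> w + s *\<^sub>R e \<in> E \<Longrightarrow> w \<in> F"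
  shows "emeasure lborel E \<le> ennreal D * emeasure lborel F"
proof -
  have "emeasure lborel E =
    (\<integral>\<^sup>+w. indicator {w. 0 \<le> l w \<and> l w < 1} w * emeasure lborel {s. w + s *\<^sub>R e \<in> E} \<partial>lborel)"
    by (rule emeasure_by_slices[OF l e]) simp
  also have "\<dots> \<le> (\<integral>\<^sup>+w. ennreal D * indicator F w \<partial>lborel)"
  proof (rule nn_integral_mono)
    fix w
    have "emeasure lborel {s. w + s *\<^sub>R e \<in> E} \<le> ennreal D"
      by (rule emeasure_diameter_le) (use D in auto)
    moreover have "emeasure lborel {s. w + s *\<^sub>R e \<in> E} = 0" if "0 \<le> l w" "l w < 1" "w \<notin> F"
    proof -
      have "{s. w + s *\<^sub>R e \<in> E} = {}" using F[of w] that by auto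
      then show ?thesis by simp
    qed
    ultimately show "indicator {w. 0 \<le> l w \<and> l w < 1} w * emeasure lborel {s. w + s *\<^sub>R e \<in> E}
        \<le> ennreal D * indicator F w"
      by (auto simp: indicator_def)
  qed
  also have "\<dots> = ennreal D * emeasure lborel F"
    by (simp add: nn_integral_cmult_indicator)
  finally show ?thesis .
qed

lemma emeasure_slices_ge:
  fixes l :: "'a::euclidean_space \<Rightarrow> real"
  assumes l: "bounded_linear l" and e: "l e = 1"
    and [measurable]: "E \<in> sets borel" "F \<in> sets borel"
    and D: "\<And>w. w \<in> F \<Longrightarrow> 0 \<le> l w \<and> l w < 1 \<and> ennreal D \<le> emeasure lborel {s. w + s *\<^sub>R e \<in> E}"
  shows "ennreal D * emeasure lborel F \<le> emeasure lborel E"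
proof -
  have "ennreal D * emeasure lborel F = (\<integral>\<^sup>+w. ennreal D * indicator F w \<partial>lborel)"
    by (simp add: nn_integral_cmult_indicator)
  also have "\<dots> \<le> (\<integral>\<^sup>+w. indicator {w. 0 \<le> l w \<and> l w < 1} w * emeasure lborel {s. w + s *\<^sub>R e \<in> E} \<partial>lborel)"
    by (rule nn_integral_mono) (use D in \<open>auto simp: indicator_def\<close>)
  also have "\<dots> = emeasure lborel E"
    by (rule emeasure_by_slices[OF l e, symmetric]) simp
  finally show ?thesis .
qed

section \<open>The volume of a thin slab in the unit ball\<close>

definition transversal :: "'n::finite horiz \<Rightarrow> 'n heis" where
  "transversal c = ((1 / (c \<bullet> c)) *\<^sub>R c, 0)"

definition plane_proj :: "'n::finite horiz \<Rightarrow> 'n heis \<Rightarrow> 'n heis" where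
  "plane_proj c w = w - (c \<bullet> fst w) *\<^sub>R transversal c"

text \<open>
  A piece of thickness one of the cylinder in the direction \<open>c\<close> over the ball of radius \<open>\<rho>\<close> in the
  vertical hyperplane normal to \<open>c\<close>.  Its volume is proportional to the area of that planar ball, so that
  volumes in the whole group can replace areas of hypersurfaces.
\<close>

definition plane_tube :: "'n::finite horiz \<Rightarrow> real \<Rightarrow> 'n heis set" where
  "plane_tube c \<rho> = {w. koranyi_norm (plane_proj c w) \<le> \<rho> \<and> 0 \<le> c \<bullet> fst w \<and> c \<bullet> fst w < 1}"

lemma inner_transversal: "c \<noteq> 0 \<Longrightarrow> c \<bullet> fst (transversal c) = 1"
  by (simp add: transversal_def)

lemma plane_proj_shift: "c \<noteq> 0 \<Longrightarrow> plane_proj c (w + s *\<^sub>R transversal c) = plane_proj c w"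
  by (simp add: plane_proj_def inner_transversal inner_simps scaleR_left_distrib)

lemma plane_proj_in: "c \<noteq> 0 \<Longrightarrow> c \<bullet> fst (plane_proj c w) = 0"
  by (simp add: plane_proj_def inner_transversal inner_simps)

lemma plane_proj_dil: "plane_proj c (heis_dil r w) = heis_dil r (plane_proj c w)"
  by (simp add: plane_proj_def heis_dil_def transversal_def prod_eq_iff scaleR_right_diff_distrib)

lemma fst_heis_dil: "fst (heis_dil r w) = r *\<^sub>R fst w"
  by (simp add: heis_dil_def)

lemma koranyi_norm_plane_proj: "koranyi_norm (plane_proj c w) \<le> koranyi_norm w"
proof (cases "c = 0")
  case True
  then show ?thesis by (simp add: plane_proj_def transversal_def zero_prod_def[symmetric])
next
  case False
  define v where "v = fst (plane_proj c w)"
  define u where "u = (c \<bullet> fst w) *\<^sub>R fst (transversal c)"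
  have "fst w = v + u" by (simp add: v_def u_def plane_proj_def)
  moreover have "v \<bullet> u = 0"
    using plane_proj_in[OF False, of w] by (simp add: v_def u_def transversal_def inner_commute)
  ultimately have "(norm (fst w))\<^sup>2 = (norm v)\<^sup>2 + (norm u)\<^sup>2"
    by (simp add: norm_add_Pythagorean orthogonal_def)
  then have "(norm v)\<^sup>2 \<le> (norm (fst w))\<^sup>2" by simp
  then have "norm v ^ 4 \<le> norm (fst w) ^ 4"
    by (simp add: power_mono)
  moreover have "snd (plane_proj c w) = snd w"
    by (simp add: plane_proj_def transversal_def)
  ultimately have "koranyi_norm (plane_proj c w) ^ 4 \<le> koranyi_norm w ^ 4"
    unfolding koranyi_norm_pow4 v_def by simp
  then show ?thesis by simp
qed

lemma measurable_plane [measurable]: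
  "plane_proj c \<in> borel_measurable borel" "(\<lambda>w. c \<bullet> fst w) \<in> borel_measurable borel"
  unfolding plane_proj_def by (intro borel_measurable_continuous_onI continuous_intros)+

lemma sets_plane_tube [measurable]: "plane_tube c \<rho> \<in> sets borel"
  unfolding plane_tube_def by measurable

lemma bounded_linear_inner_fst: "bounded_linear (\<lambda>w::'n::finite heis. c \<bullet> fst w)"
  using bounded_linear_compose[OF bounded_linear_inner_right bounded_linear_fst] by auto

text \<open>
  The dilation by \<open>\<rho>\<close> multiplies volumes by \<open>\<rho>\<close> to the power \<open>2n + 2\<close>, and one factor is spent on
  the thickness, which stays one.
\<close>

lemma emeasure_plane_tube:
  fixes c :: "'n::finite horiz"
  assumes c: "c \<noteq> 0" and \<rho>: "\<rho> > 0"
  shows "emeasure lborel (plane_tube c \<rho>)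
    = ennreal (\<rho> ^ (2 * CARD('n) + 1)) * emeasure lborel (plane_tube c 1)"
proof -
  define E where "E = {u. koranyi_norm (plane_proj c u) \<le> 1 \<and> 0 \<le> c \<bullet> fst u \<and> c \<bullet> fst u < 1 / \<rho>}"
  have [measurable]: "E \<in> sets borel" unfolding E_def by measurable
  have "{u. heis_mult 0 (heis_dil \<rho> u) \<in> plane_tube c \<rho>} = E"
    using \<rho> by (simp add: plane_tube_def E_def plane_proj_dil koranyi_norm_dil
        fst_heis_dil field_simps zero_le_mult_iff)
  then have 1: "emeasure lborel (plane_tube c \<rho>) = ennreal (\<rho> ^ (2 * CARD('n) + 2)) * emeasure lborel E"
    using emeasure_heis[OF sets_plane_tube \<rho>, of c \<rho> 0] by simp
  have "emeasure lborel E = (\<integral>\<^sup>+w. indicator {w. 0 \<le> c \<bullet> fst w \<and> c \<bullet> fst w < 1} w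
      * emeasure lborel {s. w + s *\<^sub>R transversal c \<in> E} \<partial>lborel)"
    by (rule emeasure_by_slices[OF bounded_linear_inner_fst inner_transversal[OF c]]) simp
  also have "\<dots> = (\<integral>\<^sup>+w. ennreal (1 / \<rho>) * indicator (plane_tube c 1) w \<partial>lborel)"
  proof (rule nn_integral_cong)
    fix w :: "'n heis"
    have "{s. w + s *\<^sub>R transversal c \<in> E} = (if koranyi_norm (plane_proj c w) \<le> 1
        then {- (c \<bullet> fst w)..<1 / \<rho> - c \<bullet> fst w} else {})"
      unfolding E_def by (auto simp: plane_proj_shift[OF c] inner_transversal[OF c] inner_simps)
    then show "indicator {w. 0 \<le> c \<bullet> fst w \<and> c \<bullet> fst w < 1} w
        * emeasure lborel {s. w + s *\<^sub>R transversal c \<in> E} = ennreal (1 / \<rho>) * indicator (plane_tube c 1) w"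
      using \<rho> by (simp add: indicator_def plane_tube_def)
  qed
  also have "\<dots> = ennreal (1 / \<rho>) * emeasure lborel (plane_tube c 1)"
    by (simp add: nn_integral_cmult_indicator)
  finally show ?thesis
    using \<rho> by (simp add: 1 mult.assoc[symmetric] ennreal_mult[symmetric])
qed

lemma plane_tube_finite: "emeasure lborel (plane_tube c 1) < \<infinity>" if c: "c \<noteq> 0"
proof -
  have "plane_tube c 1 \<subseteq> cball 0 (2 + norm (transversal c))"
  proof
    fix w assume w: "w \<in> plane_tube c 1"
    have "w = plane_proj c w + (c \<bullet> fst w) *\<^sub>R transversal c" by (simp add: plane_proj_def)
    then have "norm w \<le> norm (plane_proj c w) + norm ((c \<bullet> fst w) *\<^sub>R transversal c)"
      by (metis norm_triangle_ineq)
    moreover have "norm (plane_proj c w) \<le> 2"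
      using koranyi_norm_bounded[of "plane_proj c w" 1] w by (simp add: plane_tube_def)
    moreover have "norm ((c \<bullet> fst w) *\<^sub>R transversal c) \<le> norm (transversal c)"
      using w by (simp add: plane_tube_def mult_left_le_one_le)
    ultimately show "w \<in> cball 0 (2 + norm (transversal c))" by simp
  qed
  then have "emeasure lborel (plane_tube c 1) \<le> emeasure lborel (cball (0::'a heis) (2 + norm (transversal c)))"
    by (rule emeasure_mono) simp
  also have "\<dots> < \<infinity>" by (rule emeasure_lborel_cball_finite)
  finally show ?thesis .
qed

lemma plane_tube_pos: "emeasure lborel (plane_tube c 1) > 0" if c: "c \<noteq> 0"
proof -
  let ?U = "{w. koranyi_norm (plane_proj c w) < 1} \<inter> ({w. 0 < c \<bullet> fst w} \<inter> {w. c \<bullet> fst w < 1})"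
  have "open ?U"
    unfolding plane_proj_def by (intro open_Int open_Collect_less continuous_intros)
  moreover have "(1/2) *\<^sub>R transversal c \<in> ?U"
    using plane_proj_shift[OF c, of 0 "1/2"] inner_transversal[OF c]
    by (simp add: plane_proj_def)
  ultimately obtain e where e: "e > 0" "ball ((1/2) *\<^sub>R transversal c) e \<subseteq> ?U"
    using open_contains_ball by metis
  then have "ball ((1/2) *\<^sub>R transversal c) e \<subseteq> plane_tube c 1"
    by (auto simp: plane_tube_def)
  then have "emeasure lborel (ball ((1/2) *\<^sub>R transversal c) e) \<le> emeasure lborel (plane_tube c 1)"
    by (rule emeasure_mono) simp
  moreover have "emeasure lborel (ball ((1/2) *\<^sub>R transversal c) e) > 0"
    using e by (simp add: emeasure_ball unit_ball_vol_pos)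
  ultimately show ?thesis by order
qed

definition plane_area :: "'n::finite horiz \<Rightarrow> real" where
  "plane_area c = measure lborel (plane_tube c 1)"

lemma plane_area: "c \<noteq> 0 \<Longrightarrow> plane_area c > 0"
    "c \<noteq> 0 \<Longrightarrow> emeasure lborel (plane_tube c 1) = ennreal (plane_area c)"
proof -
  assume c: "c \<noteq> 0"
  show e: "emeasure lborel (plane_tube c 1) = ennreal (plane_area c)"
    unfolding plane_area_def
    by (rule emeasure_eq_ennreal_measure) (use plane_tube_finite[OF c] in auto)
  show "plane_area c > 0"
    using plane_tube_pos[OF c] e by simp
qed

text \<open>
  The Koranyi distance is not Lipschitz with respect to Euclidean shifts, but on a ball uniform
  continuity gives all that is needed of perturbations that are not group translations.
\<close>

lemma koranyi_dist_uniformly_small: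
  fixes F :: "'n::finite heis \<Rightarrow> real \<Rightarrow> 'n heis"
  assumes "\<epsilon> > 0" and F: "continuous_on UNIV (\<lambda>(w, s). F w s)" and F0: "\<And>w. F w 0 = w"
  shows "\<exists>a>0. \<forall>w s. koranyi_norm w \<le> R \<longrightarrow> \<bar>s\<bar> \<le> a \<longrightarrow> koranyi_dist w (F w s) \<le> \<epsilon>"
proof -
  define h where "h = (\<lambda>z::'n heis \<times> real. koranyi_dist (fst z) (F (fst z) (snd z)))"
  have "compact (koranyi_ball 0 R \<times> {-1..1::real})"
    by (intro compact_Times compact_koranyi_ball compact_Icc)
  moreover have "continuous_on (koranyi_ball 0 R \<times> {-1..1}) h"
    unfolding h_def using continuous_on_subset[OF F subset_UNIV]
    by (intro continuous_intros) (simp add: case_prod_beta')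
  ultimately have "uniformly_continuous_on (koranyi_ball 0 R \<times> {-1..1}) h"
    by (rule compact_uniformly_continuous[rotated])
  then obtain d where d: "d > 0" "\<And>z z'. z \<in> koranyi_ball 0 R \<times> {-1..1} \<Longrightarrow>
      z' \<in> koranyi_ball 0 R \<times> {-1..1} \<Longrightarrow> dist z' z < d \<Longrightarrow> dist (h z') (h z) < \<epsilon>"
    unfolding uniformly_continuous_on_def using assms(1) by meson
  have "koranyi_dist w (F w s) \<le> \<epsilon>" if "koranyi_norm w \<le> R" "\<bar>s\<bar> \<le> min 1 (d / 2)" for w s
  proof -
    have "dist (h (w, s)) (h (w, 0)) < \<epsilon>"
      using that d by (intro d(2)) (auto simp: mem_koranyi_ball dist_Pair_Pair)
    then show ?thesis by (simp add: h_def dist_real_def F0)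
  qed
  then show ?thesis using d(1) by (intro exI[of _ "min 1 (d / 2)"]) auto
qed

lemma koranyi_dist_shift_small:
  fixes e :: "'n::finite heis"
  assumes "\<epsilon> > 0"
  shows "\<exists>a>0. \<forall>w s. koranyi_norm w \<le> R \<longrightarrow> \<bar>s\<bar> \<le> a \<longrightarrow> koranyi_dist w (w + s *\<^sub>R e) \<le> \<epsilon>"
  by (rule koranyi_dist_uniformly_small[OF assms]) (auto simp: case_prod_beta' intro!: continuous_intros)

text \<open>
  Along the direction \<open>transversal c\<close> the function \<open>y \<mapsto> c \<bullet> y\<^sub>H + g y\<close> has slope at least \<open>1 - \<eta>\<close>,
  so each line meets the slab in a set of diameter at most \<open>2 \<delta> / (1 - \<eta>)\<close>; and only lines over the
  unit ball of the hyperplane count, because the projection does not increase the norm.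
\<close>

lemma emeasure_slab_le:
  fixes c :: "'n::finite horiz"
  assumes c: "c \<noteq> 0" and \<eta>: "0 < \<eta>" "\<eta> < 1" and [measurable]: "g \<in> borel_measurable borel"
    and lip: "\<And>y s. koranyi_norm y \<le> 1 \<Longrightarrow> koranyi_norm (y + s *\<^sub>R transversal c) \<le> 1 \<Longrightarrow>
      \<bar>g (y + s *\<^sub>R transversal c) - g y\<bar> \<le> \<eta> * \<bar>s\<bar>"
    and \<delta>: "0 < \<delta>"
  shows "emeasure lborel {y. koranyi_norm y \<le> 1 \<and> \<bar>c \<bullet> fst y + g y\<bar> < \<delta>}
    \<le> ennreal (2 * \<delta> / (1 - \<eta>)) * emeasure lborel (plane_tube c 1)"
proof -
  let ?e = "transversal c"
  let ?E = "{y. koranyi_norm y \<le> 1 \<and> \<bar>c \<bullet> fst y + g y\<bar> < \<delta>}"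
  show ?thesis
  proof (rule emeasure_slices_le[OF bounded_linear_inner_fst inner_transversal[OF c]])
    show "?E \<in> sets borel" by measurable
    fix w :: "'n heis" and s s' :: real
    {
      assume w: "w + s *\<^sub>R ?e \<in> ?E" and w': "w + s' *\<^sub>R ?e \<in> ?E"
      have "\<bar>g (w + s *\<^sub>R ?e) - g (w + s' *\<^sub>R ?e)\<bar> \<le> \<eta> * \<bar>s - s'\<bar>"
        using lip[of "w + s' *\<^sub>R ?e" "s - s'"] w w' by (simp add: algebra_simps)
      moreover have "\<bar>s - s' + (g (w + s *\<^sub>R ?e) - g (w + s' *\<^sub>R ?e))\<bar> \<le> 2 * \<delta>"
        using w w' inner_transversal[OF c] by (auto simp: inner_simps abs_if split: if_splits)
      ultimately have "\<bar>s - s'\<bar> * (1 - \<eta>) \<le> 2 * \<delta>" unfolding right_diff_distrib mult_1_right mult.commute[of \<eta>] by arith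
      then show "\<bar>s - s'\<bar> \<le> 2 * \<delta> / (1 - \<eta>)"
        using \<eta> by (simp add: pos_le_divide_eq)
    }
    assume "0 \<le> c \<bullet> fst w" "c \<bullet> fst w < 1" "w + s *\<^sub>R ?e \<in> ?E"
    then show "w \<in> plane_tube c 1"
      using koranyi_norm_plane_proj[of c "w + s *\<^sub>R ?e"]
      by (simp add: plane_tube_def plane_proj_shift[OF c])
  qed simp
qed

text \<open>
  Conversely, every line over a slightly smaller ball of the hyperplane meets the zero set of
  \<open>c \<bullet> y\<^sub>H + g y\<close> near the hyperplane, and the slope there is at most \<open>1 + \<eta>\<close>.
\<close>

lemma emeasure_slab_ge:
  fixes c :: "'n::finite horiz"
  assumes c: "c \<noteq> 0" and \<eta>: "0 < \<eta>" and g: "continuous_on UNIV g"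
    and bd: "\<And>y. koranyi_norm y \<le> 1 \<Longrightarrow> \<bar>g y\<bar> \<le> \<eta>"
    and lip: "\<And>y s. koranyi_norm y \<le> 1 \<Longrightarrow> koranyi_norm (y + s *\<^sub>R transversal c) \<le> 1 \<Longrightarrow>
      \<bar>g (y + s *\<^sub>R transversal c) - g y\<bar> \<le> \<eta> * \<bar>s\<bar>"
    and \<delta>: "0 < \<delta>"
    and a: "\<And>w s. koranyi_norm w \<le> 1 - \<tau> \<Longrightarrow> \<bar>s\<bar> \<le> \<eta> + \<delta> \<Longrightarrow> koranyi_norm (w + s *\<^sub>R transversal c) \<le> 1"
  shows "ennreal (2 * \<delta> / (1 + \<eta>)) * emeasure lborel (plane_tube c (1 - \<tau>))
    \<le> emeasure lborel {y. koranyi_norm y \<le> 1 \<and> \<bar>c \<bullet> fst y + g y\<bar> < \<delta>}"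
proof -
  let ?e = "transversal c"
  let ?E = "{y. koranyi_norm y \<le> 1 \<and> \<bar>c \<bullet> fst y + g y\<bar> < \<delta>}"
  have [measurable]: "g \<in> borel_measurable borel"
    using g by (rule borel_measurable_continuous_onI)
  show ?thesis
  proof (rule emeasure_slices_ge[OF bounded_linear_inner_fst inner_transversal[OF c]])
    show E [measurable]: "?E \<in> sets borel" by measurable
    fix w assume w: "w \<in> plane_tube c (1 - \<tau>)"
    define p where "p = plane_proj c w"
    have p: "koranyi_norm p \<le> 1 - \<tau>" "w = p + (c \<bullet> fst w) *\<^sub>R ?e" "c \<bullet> fst p = 0"
      using w plane_proj_in[OF c] by (simp_all add: plane_tube_def p_def plane_proj_def)
    have pN: "koranyi_norm (p + s *\<^sub>R ?e) \<le> 1" if "\<bar>s\<bar> \<le> \<eta> + \<delta>" for s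
      using a p(1) that by blast
    \<comment> \<open>On the line through \<open>p\<close> the defining function has a zero \<open>s0\<close>, and its slope is at most \<open>1 + \<eta>\<close>.\<close>
    define h where "h s = s + g (p + s *\<^sub>R ?e)" for s
    have "continuous_on {-\<eta>..\<eta>} h"
      unfolding h_def by (intro continuous_intros continuous_on_compose2[OF g]) auto
    moreover have "h (- \<eta>) \<le> 0" "0 \<le> h \<eta>"
      using bd[OF pN, of "- \<eta>"] bd[OF pN, of \<eta>] \<eta> \<delta> by (auto simp: h_def)
    ultimately obtain s0 where s0: "- \<eta> \<le> s0" "s0 \<le> \<eta>" "h s0 = 0"
      using IVT'[of h "- \<eta>" 0 \<eta>] \<eta> by auto
    have "ball (s0 - c \<bullet> fst w) (\<delta> / (1 + \<eta>)) \<subseteq> {s. w + s *\<^sub>R ?e \<in> ?E}"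
    proof
      fix s assume "s \<in> ball (s0 - c \<bullet> fst w) (\<delta> / (1 + \<eta>))"
      then have s: "\<bar>s + c \<bullet> fst w - s0\<bar> < \<delta> / (1 + \<eta>)"
        by (simp add: dist_real_def abs_minus_commute algebra_simps)
      let ?s = "s + c \<bullet> fst w"
      have s1: "\<bar>?s - s0\<bar> * (1 + \<eta>) < \<delta>" using s \<eta> by (simp add: pos_less_divide_eq)
      have "\<bar>?s - s0\<bar> \<le> \<bar>?s - s0\<bar> * (1 + \<eta>)" using \<eta> by (simp add: mult_le_cancel_left1)
      then have s2: "\<bar>?s\<bar> \<le> \<eta> + \<delta>" using s0 s1 by linarith
      have "\<bar>g (p + ?s *\<^sub>R ?e) - g (p + s0 *\<^sub>R ?e)\<bar> \<le> \<eta> * \<bar>?s - s0\<bar>"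
        using lip[OF pN[of s0], of "?s - s0"] pN[OF s2] s0 \<delta> by (simp add: algebra_simps)
      then have "\<bar>h ?s - h s0\<bar> \<le> \<bar>?s - s0\<bar> * (1 + \<eta>)"
        unfolding h_def distrib_left mult_1_right mult.commute[of \<eta>] by arith
      then have "\<bar>h ?s\<bar> < \<delta>" using s1 s0 by simp
      moreover have ws: "w + s *\<^sub>R ?e = p + ?s *\<^sub>R ?e"
        by (subst p(2)) (simp add: algebra_simps)
      ultimately show "s \<in> {s. w + s *\<^sub>R ?e \<in> ?E}"
        unfolding mem_Collect_eq ws using pN[OF s2] inner_transversal[OF c]
        by (simp add: h_def inner_simps p(3))
    qed
    then have "emeasure lborel (ball (s0 - c \<bullet> fst w) (\<delta> / (1 + \<eta>))) \<le> emeasure lborel {s. w + s *\<^sub>R ?e \<in> ?E}"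
      by (rule emeasure_mono) measurable
    moreover have "emeasure lborel (ball (s0 - c \<bullet> fst w) (\<delta> / (1 + \<eta>))) = ennreal (2 * \<delta> / (1 + \<eta>))"
      using \<eta> \<delta> by (simp add: ball_eq_greaterThanLessThan)
    ultimately show "0 \<le> c \<bullet> fst w \<and> c \<bullet> fst w < 1 \<and>
        ennreal (2 * \<delta> / (1 + \<eta>)) \<le> emeasure lborel {s. w + s *\<^sub>R ?e \<in> ?E}"
      using w by (simp add: plane_tube_def)
  qed simp
qed

section \<open>Thin neighbourhoods of a quadric\<close>

lemma koranyi_norm_le_dist: "koranyi_norm y \<le> koranyi_norm x + koranyi_dist x y"
  using koranyi_dist_triangle[of 0 y x] by simp

text \<open>
  A surface that is \<open>C\<^sup>1\<close>-close to a vertical hyperplane along the transversal direction has, in the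
  unit ball, almost the area of the hyperplane; the area is measured by the volume of a thin slab.
\<close>

lemma emeasure_slab:
  fixes c :: "'n::finite horiz"
  assumes c: "c \<noteq> 0" and \<tau>: "0 < \<tau>" "\<tau> < 1"
  shows "\<exists>\<eta>>0. \<forall>g \<delta>. continuous_on UNIV g \<longrightarrow>
     (\<forall>y. koranyi_norm y \<le> 1 \<longrightarrow> \<bar>g y\<bar> \<le> \<eta>) \<longrightarrow>
     (\<forall>y s. koranyi_norm y \<le> 1 \<longrightarrow> koranyi_norm (y + s *\<^sub>R transversal c) \<le> 1 \<longrightarrow>
      \<bar>g (y + s *\<^sub>R transversal c) - g y\<bar> \<le> \<eta> * \<bar>s\<bar>) \<longrightarrow> 0 < \<delta> \<longrightarrow> \<delta> \<le> \<eta> \<longrightarrow>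
     ennreal ((1 - \<tau>) * (2 * \<delta> * plane_area c))
       \<le> emeasure lborel {y. koranyi_norm y \<le> 1 \<and> \<bar>c \<bullet> fst y + g y\<bar> < \<delta>} \<and>
     emeasure lborel {y. koranyi_norm y \<le> 1 \<and> \<bar>c \<bullet> fst y + g y\<bar> < \<delta>}
       \<le> ennreal ((1 + \<tau>) * (2 * \<delta> * plane_area c))"
proof -
  define m where "m = 2 * CARD('n) + 1"
  define \<tau>1 where "\<tau>1 = \<tau> / (2 * real m)"
  have m: "real m \<ge> 1" by (simp add: m_def)
  have t1: "0 < \<tau>1" "\<tau>1 < 1"
    using \<tau> m by (simp_all add: \<tau>1_def field_simps)
  \<comment> \<open>Shrinking the planar ball by \<open>\<tau>1\<close> costs at most half of the admissible relative error.\<close>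
  have "1 + real m * (- \<tau>1) \<le> (1 + (- \<tau>1)) ^ m"
    by (rule Bernoulli_inequality) (use t1 in simp)
  then have t2: "1 - \<tau> / 2 \<le> (1 - \<tau>1) ^ m" using m by (simp add: \<tau>1_def)
  obtain a where a: "a > 0" "\<And>w s. koranyi_norm w \<le> 1 - \<tau>1 \<Longrightarrow> \<bar>s\<bar> \<le> a \<Longrightarrow>
      koranyi_dist w (w + s *\<^sub>R transversal c) \<le> \<tau>1"
    using koranyi_dist_shift_small[OF t1(1), of "1 - \<tau>1" "transversal c"] by blast
  define \<eta> where "\<eta> = min (a / 2) (\<tau> / 4)"
  have \<eta>: "0 < \<eta>" "\<eta> < 1" "\<eta> \<le> a / 2" "\<eta> \<le> \<tau> / 4" using a \<tau> by (auto simp: \<eta>_def)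
  have w: "plane_area c > 0" using plane_area[OF c] by simp
  have up: "1 / (1 - \<eta>) \<le> 1 + \<tau>"
  proof -
    have "\<eta> * (1 + \<tau>) \<le> \<tau> / 4 * 2" using \<eta> \<tau> by (intro mult_mono) auto
    then have "1 \<le> (1 + \<tau>) * (1 - \<eta>)" using \<tau> by (simp add: algebra_simps)
    then show ?thesis using \<eta> by (simp add: pos_divide_le_eq)
  qed
  have lo: "1 - \<tau> \<le> (1 - \<tau>1) ^ m / (1 + \<eta>)"
  proof -
    have "\<eta> * (1 - \<tau>) \<le> \<tau> / 4 * 1" using \<eta> \<tau> by (intro mult_mono) auto
    then have "(1 - \<tau>) * (1 + \<eta>) \<le> 1 - \<tau> / 2" using \<tau> by (simp add: algebra_simps)
    then show ?thesis using \<eta> t2 by (simp add: pos_le_divide_eq)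
  qed
  show ?thesis
  proof (intro exI[of _ \<eta>] conjI allI impI \<eta>(1))
    fix g :: "'n heis \<Rightarrow> real" and \<delta> :: real
    assume g: "continuous_on UNIV g"
      and bd: "\<forall>y. koranyi_norm y \<le> 1 \<longrightarrow> \<bar>g y\<bar> \<le> \<eta>"
      and lip: "\<forall>y s. koranyi_norm y \<le> 1 \<longrightarrow> koranyi_norm (y + s *\<^sub>R transversal c) \<le> 1 \<longrightarrow>
        \<bar>g (y + s *\<^sub>R transversal c) - g y\<bar> \<le> \<eta> * \<bar>s\<bar>"
      and \<delta>: "0 < \<delta>" "\<delta> \<le> \<eta>"
    let ?E = "{y. koranyi_norm y \<le> 1 \<and> \<bar>c \<bullet> fst y + g y\<bar> < \<delta>}"
    have gm: "g \<in> borel_measurable borel" using g by (rule borel_measurable_continuous_onI)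
    have "emeasure lborel ?E \<le> ennreal (2 * \<delta> / (1 - \<eta>)) * emeasure lborel (plane_tube c 1)"
      by (rule emeasure_slab_le[OF c \<eta>(1,2) gm]) (use lip \<delta> in auto)
    also have "\<dots> = ennreal (1 / (1 - \<eta>) * (2 * \<delta> * plane_area c))"
      using \<delta> \<eta> w by (simp add: plane_area(2)[OF c] ennreal_mult[symmetric])
    also have "\<dots> \<le> ennreal ((1 + \<tau>) * (2 * \<delta> * plane_area c))"
      by (intro ennreal_leI mult_right_mono up) (use \<delta> w in simp)
    finally show "emeasure lborel ?E \<le> ennreal ((1 + \<tau>) * (2 * \<delta> * plane_area c))" .
    have "ennreal ((1 - \<tau>) * (2 * \<delta> * plane_area c))
        \<le> ennreal ((1 - \<tau>1) ^ m / (1 + \<eta>) * (2 * \<delta> * plane_area c))"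
      by (intro ennreal_leI mult_right_mono lo) (use \<delta> w in simp)
    also have "\<dots> = ennreal (2 * \<delta> / (1 + \<eta>)) * emeasure lborel (plane_tube c (1 - \<tau>1))"
      using \<delta> \<eta> w t1 by (simp add: emeasure_plane_tube[OF c] plane_area(2)[OF c] ennreal_mult[symmetric] m_def)
    also have "\<dots> \<le> emeasure lborel ?E"
    proof (rule emeasure_slab_ge[OF c \<eta>(1) g])
      fix w :: "'n heis" and s
      assume "koranyi_norm w \<le> 1 - \<tau>1" "\<bar>s\<bar> \<le> \<eta> + \<delta>"
      then show "koranyi_norm (w + s *\<^sub>R transversal c) \<le> 1"
        using a(2)[of w s] \<eta> \<delta> koranyi_norm_le_dist[of "w + s *\<^sub>R transversal c" w] by linarith
    qed (use bd lip \<delta> in auto)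
    finally show "ennreal ((1 - \<tau>) * (2 * \<delta> * plane_area c)) \<le> emeasure lborel ?E" .
  qed
qed

definition quadric_fun ::
    "'n::finite horiz \<Rightarrow> real ^ ('n + 'n) ^ ('n + 'n) \<Rightarrow> real \<Rightarrow> 'n heis \<Rightarrow> real" where
  "quadric_fun b Q T z = b \<bullet> fst z + fst z \<bullet> (Q *v fst z) + T * snd z"

text \<open>
  The horizontal gradient: the derivatives of the polynomial along the left-invariant horizontal fields,
  which differ from the partial derivatives by the term with \<open>J_mat\<close>.
\<close>

definition quadric_hgrad ::
    "'n::finite horiz \<Rightarrow> real ^ ('n + 'n) ^ ('n + 'n) \<Rightarrow> real \<Rightarrow> 'n heis \<Rightarrow> 'n horiz" where
  "quadric_hgrad b Q T z = b + 2 *\<^sub>R (Q *v fst z) - (2 * T) *\<^sub>R (J_mat *v fst z)"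

lemma mem_quadric: "z \<in> quadric b Q T \<longleftrightarrow> quadric_fun b Q T z = 0"
  by (cases z) (simp add: quadric_def quadric_fun_def)

lemma symmetric_inner: "transpose Q = Q \<Longrightarrow> x \<bullet> (Q *v y) = (Q *v x) \<bullet> y" for Q :: "real^'a::finite^'a"
  using dot_lmul_matrix[of x Q y] transpose_matrix_vector[of Q x] by simp

text \<open>
  The Taylor expansion at \<open>x\<close> in group coordinates; it is exact, and its second-order part does not
  depend on \<open>x\<close>.
\<close>

lemma quadric_fun_mult:
  assumes Q: "transpose Q = Q"
  shows "quadric_fun b Q T (heis_mult x y)
    = quadric_fun b Q T x + quadric_hgrad b Q T x \<bullet> fst y + quadric_fun 0 Q T y"
proof -
  define a where "a = fst x"
  define u where "u = fst y"
  have sym: "a \<bullet> (Q *v u) = u \<bullet> (Q *v a)" "(Q *v a) \<bullet> u = u \<bullet> (Q *v a)"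
    "a \<bullet> (J_mat *v u) = - (u \<bullet> (J_mat *v a))" "(J_mat *v a) \<bullet> u = u \<bullet> (J_mat *v a)"
    using symmetric_inner[OF Q, of a u] inner_J_mat_swap[of a u] by (simp_all only: inner_commute)
  show ?thesis
    unfolding quadric_fun_def quadric_hgrad_def heis_mult_def fst_conv snd_conv a_def[symmetric]
      u_def[symmetric] matrix_vector_right_distrib inner_add_left inner_add_right inner_diff_left
      inner_scaleR_left sym inner_zero_left
    by (simp add: algebra_simps)
qed

lemma quadric_fun_0_dil: "quadric_fun 0 Q T (heis_dil r u) = r\<^sup>2 * quadric_fun 0 Q T u"
  by (simp add: quadric_fun_def heis_dil_def mat_scaleR power2_eq_square algebra_simps)

lemma continuous_on_quadric [continuous_intros]:
  "continuous_on A f \<Longrightarrow> continuous_on A (\<lambda>x. quadric_fun b Q T (f x))"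
  "continuous_on A f \<Longrightarrow> continuous_on A (\<lambda>x. quadric_hgrad b Q T (f x))"
  unfolding quadric_fun_def quadric_hgrad_def by (auto intro!: continuous_intros)

lemma measurable_quadric_fun [measurable]: "quadric_fun b Q T \<in> borel_measurable borel"
  by (intro borel_measurable_continuous_onI continuous_intros)

lemma matrix_bound: "\<exists>K>0. \<forall>y. norm (M *v y) \<le> K * norm (y :: real^'a::finite)" for M :: "real^'a^'b::finite"
  using bounded_linear.pos_bounded[OF matrix_vector_mul_bounded_linear[of M]]
  by (metis mult.commute)

text \<open>
  Rescaling the ball to the unit ball turns the quadric into the zero set of a function
  \<open>c \<bullet> u\<^sub>H + g u\<close>, where \<open>c\<close> is the gradient at \<open>p\<close> and \<open>g\<close> collects the change of the gradient
  between \<open>p\<close> and \<open>x\<close> and \<open>r\<close> times the second-order part; both are small when \<open>x\<close> is near \<open>p\<close> and \<open>r\<close>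
  is small.  The constant \<open>plane_area\<close> is the same for all such \<open>x\<close> and \<open>r\<close>.
\<close>

lemma quadric_ball_measure:
  fixes b :: "'n::finite horiz"
  assumes Q: "transpose Q = Q" and c: "quadric_hgrad b Q T p \<noteq> 0" and \<tau>: "0 < \<tau>" "\<tau> < 1"
  shows "\<exists>\<rho>>0. \<exists>\<kappa>>0. \<forall>x r \<delta>. x \<in> quadric b Q T \<longrightarrow> koranyi_dist p x < \<rho> \<longrightarrow> 0 < r \<longrightarrow> r \<le> \<rho> \<longrightarrow>
     0 < \<delta> \<longrightarrow> \<delta> \<le> \<kappa> * r \<longrightarrow>
     ennreal ((1 - \<tau>) * (2 * \<delta> * plane_area (quadric_hgrad b Q T p) * r ^ (2 * CARD('n) + 1)))
       \<le> emeasure lborel {z. koranyi_dist x z \<le> r \<and> \<bar>quadric_fun b Q T z\<bar> < \<delta>} \<and>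
     emeasure lborel {z. koranyi_dist x z \<le> r \<and> \<bar>quadric_fun b Q T z\<bar> < \<delta>}
       \<le> ennreal ((1 + \<tau>) * (2 * \<delta> * plane_area (quadric_hgrad b Q T p) * r ^ (2 * CARD('n) + 1)))"
proof -
  define c where "c = quadric_hgrad b Q T p"
  have c0: "c \<noteq> 0" using c by (simp add: c_def)
  let ?e = "transversal c"
  obtain \<eta> where \<eta>: "\<eta> > 0" and slab: "\<And>g \<delta>. continuous_on UNIV g \<Longrightarrow>
     (\<And>y. koranyi_norm y \<le> 1 \<Longrightarrow> \<bar>g y\<bar> \<le> \<eta>) \<Longrightarrow>
     (\<And>y s. koranyi_norm y \<le> 1 \<Longrightarrow> koranyi_norm (y + s *\<^sub>R ?e) \<le> 1 \<Longrightarrow>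
      \<bar>g (y + s *\<^sub>R ?e) - g y\<bar> \<le> \<eta> * \<bar>s\<bar>) \<Longrightarrow> 0 < \<delta> \<Longrightarrow> \<delta> \<le> \<eta> \<Longrightarrow>
     ennreal ((1 - \<tau>) * (2 * \<delta> * plane_area c))
       \<le> emeasure lborel {y. koranyi_norm y \<le> 1 \<and> \<bar>c \<bullet> fst y + g y\<bar> < \<delta>} \<and>
     emeasure lborel {y. koranyi_norm y \<le> 1 \<and> \<bar>c \<bullet> fst y + g y\<bar> < \<delta>}
       \<le> ennreal ((1 + \<tau>) * (2 * \<delta> * plane_area c))"
    using emeasure_slab[OF c0 \<tau>] by blast
  obtain K where K: "K > 0" "\<And>y. norm (Q *v y) \<le> K * norm y"
    using matrix_bound[of Q] by blast
  define M where "M = 1 + norm ?e"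
  have M: "M \<ge> 1" "norm ?e \<le> M" by (simp_all add: M_def)
  define B where "B = 2 * K + \<bar>T\<bar> + 1"
  have B: "B > 0" using K by (simp add: B_def)
  have op: "open {x. norm (quadric_hgrad b Q T x - c) < \<eta> / (2 * M)}"
    by (intro open_Collect_less continuous_intros)
  have pin: "p \<in> {x. norm (quadric_hgrad b Q T x - c) < \<eta> / (2 * M)}"
    using \<eta> M by (simp add: c_def)
  obtain \<rho>1 where \<rho>1: "\<rho>1 > 0"
      "\<And>x. koranyi_dist p x < \<rho>1 \<Longrightarrow> norm (quadric_hgrad b Q T x - c) < \<eta> / (2 * M)"
    using koranyi_ball_open_nbhd[OF op pin] by auto
  define \<rho> where "\<rho> = min \<rho>1 (\<eta> / (2 * M * B))"
  have \<rho>: "\<rho> > 0" using \<rho>1 \<eta> M B by (simp add: \<rho>_def)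
  have main: "ennreal ((1 - \<tau>) * (2 * \<delta> * plane_area c * r ^ (2 * CARD('n) + 1)))
       \<le> emeasure lborel {z. koranyi_dist x z \<le> r \<and> \<bar>quadric_fun b Q T z\<bar> < \<delta>} \<and>
     emeasure lborel {z. koranyi_dist x z \<le> r \<and> \<bar>quadric_fun b Q T z\<bar> < \<delta>}
       \<le> ennreal ((1 + \<tau>) * (2 * \<delta> * plane_area c * r ^ (2 * CARD('n) + 1)))"
    if x: "x \<in> quadric b Q T" "koranyi_dist p x < \<rho>" and r: "0 < r" "r \<le> \<rho>"
      and \<delta>: "0 < \<delta>" "\<delta> \<le> \<eta> * r" for x r \<delta>
  proof -
    define v where "v = quadric_hgrad b Q T x - c"
    have v: "norm v \<le> \<eta> / (2 * M)" using \<rho>1(2)[of x] x by (simp add: v_def \<rho>_def)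
    define g where "g u = v \<bullet> fst u + r * quadric_fun 0 Q T u" for u
    have rB: "r * B \<le> \<eta> / (2 * M)"
    proof -
      have "r * B \<le> \<eta> / (2 * M * B) * B" using r B by (intro mult_right_mono) (auto simp: \<rho>_def)
      then show ?thesis using B by simp
    qed
    have half: "\<eta> / (2 * M) + \<eta> / (2 * M) = \<eta> / M" by simp
    have \<eta>M: "\<eta> / M \<le> \<eta>" using M \<eta> by (simp add: pos_divide_le_eq)
    have cont: "continuous_on UNIV g" unfolding g_def by (intro continuous_intros)
    have bd: "\<bar>g u\<bar> \<le> \<eta>" if u: "koranyi_norm u \<le> 1" for u
    proof -
      have u1: "norm (fst u) \<le> 1" using norm_fst_le_koranyi[of u] u by simp
      have u2: "\<bar>snd u\<bar> \<le> 1" using abs_snd_le_koranyi[of u] u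
        by (meson koranyi_norm_nonneg order_trans power_le_one)
      have "\<bar>fst u \<bullet> (Q *v fst u)\<bar> \<le> norm (fst u) * norm (Q *v fst u)" by (rule Cauchy_Schwarz_ineq2)
      also have "\<dots> \<le> 1 * (K * 1)"
        using u1 K by (intro mult_mono order_trans[OF K(2)] mult_left_mono) auto
      finally have 1: "\<bar>fst u \<bullet> (Q *v fst u)\<bar> \<le> K" by simp
      have "\<bar>T * snd u\<bar> \<le> \<bar>T\<bar> * 1" unfolding abs_mult using u2 by (intro mult_left_mono) auto
      then have "\<bar>quadric_fun 0 Q T u\<bar> \<le> B"
        unfolding quadric_fun_def B_def using 1 K(1) by simp
      then have 2: "\<bar>r * quadric_fun 0 Q T u\<bar> \<le> r * B" using r by (simp add: abs_mult)
      have "\<bar>v \<bullet> fst u\<bar> \<le> norm v * norm (fst u)" by (rule Cauchy_Schwarz_ineq2)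
      also have "\<dots> \<le> norm v * 1" using u1 by (intro mult_left_mono) auto
      finally show ?thesis unfolding g_def using 2 rB v half \<eta>M by linarith
    qed
    have lip: "\<bar>g (y + s *\<^sub>R ?e) - g y\<bar> \<le> \<eta> * \<bar>s\<bar>"
      if y: "koranyi_norm y \<le> 1" and y': "koranyi_norm (y + s *\<^sub>R ?e) \<le> 1" for y s
    proof -
      define eH where "eH = fst ?e"
      define h where "h = fst y"
      define h' where "h' = fst (y + s *\<^sub>R ?e)"
      have eH: "norm eH \<le> M" using M norm_fst_le[of "fst ?e" "snd ?e"] by (simp add: eH_def)
      have h: "norm (h' + h) \<le> 2"
        using norm_fst_le_koranyi[of y] y norm_fst_le_koranyi[of "y + s *\<^sub>R ?e"] y'
          norm_triangle_ineq[of h' h] unfolding h_def h'_def by linarith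
      have h'h: "h' = h + s *\<^sub>R eH" by (simp add: h_def h'_def eH_def)
      have "g (y + s *\<^sub>R ?e) - g y = v \<bullet> h' - v \<bullet> h + r * (h' \<bullet> (Q *v h') - h \<bullet> (Q *v h))"
        by (simp add: g_def quadric_fun_def h_def h'_def algebra_simps transversal_def)
      also have "h' \<bullet> (Q *v h') - h \<bullet> (Q *v h) = (h' - h) \<bullet> (Q *v (h' + h))"
        using symmetric_inner[OF Q, of h' h]
        by (simp add: matrix_vector_right_distrib inner_simps inner_commute)
      also have "v \<bullet> h' - v \<bullet> h + r * ((h' - h) \<bullet> (Q *v (h' + h)))
          = s * (v \<bullet> eH + r * (eH \<bullet> (Q *v (h' + h))))"
        unfolding inner_diff_right[symmetric] by (simp add: h'h algebra_simps)
      finally have eq: "g (y + s *\<^sub>R ?e) - g y = s * (v \<bullet> eH + r * (eH \<bullet> (Q *v (h' + h))))" .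
      have 1: "\<bar>v \<bullet> eH\<bar> \<le> \<eta> / (2 * M) * M"
        by (rule order_trans[OF Cauchy_Schwarz_ineq2], rule mult_mono[OF v eH]) (use \<eta> M in simp_all)
      have "\<bar>eH \<bullet> (Q *v (h' + h))\<bar> \<le> M * (K * 2)"
        by (rule order_trans[OF Cauchy_Schwarz_ineq2], rule mult_mono[OF eH order_trans[OF K(2)]])
           (use h K M in \<open>auto intro!: mult_left_mono\<close>)
      also have "\<dots> \<le> M * B" using M by (simp add: B_def)
      finally have "r * \<bar>eH \<bullet> (Q *v (h' + h))\<bar> \<le> r * (M * B)" using r by (intro mult_left_mono) auto
      also have "\<dots> = (r * B) * M" by simp
      also have "\<dots> \<le> \<eta> / (2 * M) * M" using M by (intro mult_right_mono rB) auto
      finally have 2: "\<bar>r * (eH \<bullet> (Q *v (h' + h)))\<bar> \<le> \<eta> / (2 * M) * M" using r by (simp add: abs_mult)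
      have 3: "\<eta> / (2 * M) * M + \<eta> / (2 * M) * M = \<eta>" using M by simp
      have "\<bar>v \<bullet> eH + r * (eH \<bullet> (Q *v (h' + h)))\<bar> \<le> \<eta>" using 1 2 3 by linarith
      then show ?thesis unfolding eq abs_mult mult.commute[of \<eta>] by (intro mult_left_mono) auto
    qed
    define E where "E = {y. koranyi_norm y \<le> 1 \<and> \<bar>c \<bullet> fst y + g y\<bar> < \<delta> / r}"
    have dr: "0 < \<delta> / r" "\<delta> / r \<le> \<eta>" using \<delta> r by (simp_all add: pos_divide_le_eq)
    note slab' = slab[OF cont bd lip dr, folded E_def]
    define E' where "E' = {z. koranyi_dist x z \<le> r \<and> \<bar>quadric_fun b Q T z\<bar> < \<delta>}"
    have E'm: "E' \<in> sets borel" unfolding E'_def by measurable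
    have "{u. heis_mult x (heis_dil r u) \<in> E'} = E"
    proof -
      have "quadric_fun b Q T (heis_mult x (heis_dil r u)) = r * (c \<bullet> fst u + g u)" for u
        using x by (simp add: quadric_fun_mult[OF Q] mem_quadric quadric_fun_0_dil fst_heis_dil
            g_def v_def inner_simps algebra_simps power2_eq_square)
      then show ?thesis using r
        by (simp add: E'_def E_def koranyi_dist_mult koranyi_norm_dil abs_mult pos_less_divide_eq mult.commute)
    qed
    then have E': "emeasure lborel E' = ennreal (r ^ (2 * CARD('n) + 2)) * emeasure lborel E"
      using emeasure_heis[OF E'm r(1), of x] by simp
    have pa: "plane_area c > 0" by (rule plane_area[OF c0])
    have rr: "ennreal (r ^ (2 * CARD('n) + 2)) * ennreal (A * (2 * (\<delta> / r) * plane_area c))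
        = ennreal (A * (2 * \<delta> * plane_area c * r ^ (2 * CARD('n) + 1)))" if "A \<ge> 0" for A
      using that r \<delta> pa by (simp add: ennreal_mult[symmetric] field_simps)
    have A: "0 \<le> 1 - \<tau>" "0 \<le> 1 + \<tau>" using \<tau> by simp_all
    have "emeasure lborel E' \<le> ennreal ((1 + \<tau>) * (2 * \<delta> * plane_area c * r ^ (2 * CARD('n) + 1)))"
      unfolding E' rr[OF A(2), symmetric] by (rule mult_left_mono[OF conjunct2[OF slab'] zero_le])
    moreover have "ennreal ((1 - \<tau>) * (2 * \<delta> * plane_area c * r ^ (2 * CARD('n) + 1))) \<le> emeasure lborel E'"
      unfolding E' rr[OF A(1), symmetric] by (rule mult_left_mono[OF conjunct1[OF slab'] zero_le])
    ultimately show ?thesis unfolding E'_def by blast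
  qed
  show ?thesis
    unfolding c_def[symmetric] using main \<rho> \<eta> by blast
qed

section \<open>Tangent groups of a quadric\<close>

lemma mem_blowup:
  assumes r: "r > 0"
  shows "y \<in> blowup S z r \<longleftrightarrow> heis_mult z (heis_dil r y) \<in> S"
proof
  assume "y \<in> blowup S z r"
  then show "heis_mult z (heis_dil r y) \<in> S" using r by (auto simp: blowup_def)
next
  assume "heis_mult z (heis_dil r y) \<in> S"
  then have "heis_dil (1 / r) (heis_mult (heis_inv z) (heis_mult z (heis_dil r y))) \<in> blowup S z r"
    unfolding blowup_def by (intro imageI)
  then show "y \<in> blowup S z r" using r by simp
qed

lemma mem_blowup_quadric:
  assumes Q: "transpose Q = Q" and r: "r > 0" and z: "z \<in> quadric b Q T"
  shows "y \<in> blowup (quadric b Q T) z r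
    \<longleftrightarrow> quadric_hgrad b Q T z \<bullet> fst y + r * quadric_fun 0 Q T y = 0"
proof -
  have "quadric_fun b Q T (heis_mult z (heis_dil r y))
      = r * (quadric_hgrad b Q T z \<bullet> fst y + r * quadric_fun 0 Q T y)"
    using z by (simp add: quadric_fun_mult[OF Q] mem_quadric quadric_fun_0_dil fst_heis_dil
        power2_eq_square algebra_simps)
  then show ?thesis using r by (simp add: mem_blowup mem_quadric)
qed

lemma koranyi_excess_le:
  assumes "\<And>a. a \<in> A \<Longrightarrow> \<exists>b\<in>B. koranyi_dist a b \<le> \<epsilon>"
  shows "koranyi_excess A B \<le> ennreal \<epsilon>"
  unfolding koranyi_excess_def
proof (rule SUP_least)
  fix a assume "a \<in> A"
  then obtain b where "b \<in> B" "koranyi_dist a b \<le> \<epsilon>" using assms by blast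
  then show "(INF b\<in>B. ennreal (koranyi_dist a b)) \<le> ennreal \<epsilon>"
    by (intro INF_lower2[of b]) (auto intro: ennreal_leI)
qed

lemma koranyi_excess_0_subset:
  assumes "koranyi_excess A B = 0" and B: "closed B"
  shows "A \<subseteq> B"
proof
  fix a assume a: "a \<in> A"
  show "a \<in> B"
  proof (rule ccontr)
    assume "a \<notin> B"
    then obtain \<epsilon> where \<epsilon>: "\<epsilon> > 0" "\<forall>x. koranyi_dist a x < \<epsilon> \<longrightarrow> x \<in> - B"
      using koranyi_ball_open_nbhd[of "- B" a] B by (auto simp: open_closed)
    have "ennreal \<epsilon> \<le> (INF b\<in>B. ennreal (koranyi_dist a b))"
      by (rule INF_greatest, rule ennreal_leI) (use \<epsilon> in force)
    also have "\<dots> \<le> koranyi_excess A B"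
      unfolding koranyi_excess_def using a by (rule SUP_upper)
    finally show False using assms(1) \<epsilon>(1) by simp
  qed
qed

lemma tendsto_0_at_right_ennreal:
  fixes f :: "real \<Rightarrow> ennreal"
  assumes "\<And>\<epsilon>. \<epsilon> > 0 \<Longrightarrow> \<exists>b>0. \<forall>r. 0 < r \<longrightarrow> r < b \<longrightarrow> f r \<le> ennreal \<epsilon>"
  shows "(f \<longlongrightarrow> 0) (at_right 0)"
proof (rule order_tendstoI)
  fix u :: ennreal assume "0 < u"
  then obtain v where v: "0 < v" "v < u" using dense by blast
  then have "v < top" using top.not_eq_extremum by fastforce
  then have v': "v = ennreal (enn2real v)" "enn2real v > 0"
    using v by (simp_all add: enn2real_positive_iff)
  obtain b where "b > 0" "\<forall>r. 0 < r \<longrightarrow> r < b \<longrightarrow> f r \<le> ennreal (enn2real v)"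
    using assms[OF v'(2)] by blast
  then show "\<forall>\<^sub>F r in at_right 0. f r < u"
    unfolding eventually_at_right_field using v v'(1) by (intro exI[of _ b]) (auto intro: le_less_trans)
qed simp

lemma quadric_fun_bounded: "\<exists>C>0. \<forall>y. koranyi_norm y \<le> R \<longrightarrow> \<bar>quadric_fun b Q T y\<bar> \<le> C"
proof -
  have "compact (quadric_fun b Q T ` koranyi_ball 0 R)"
    by (intro compact_continuous_image compact_koranyi_ball continuous_intros)
  then have "bounded (quadric_fun b Q T ` koranyi_ball 0 R)" by (rule compact_imp_bounded)
  then obtain C where "C > 0" "\<forall>x\<in>quadric_fun b Q T ` koranyi_ball 0 R. norm x \<le> C"
    unfolding bounded_pos by blast
  then show ?thesis by (intro exI[of _ C]) (auto simp: mem_koranyi_ball)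
qed

text \<open>
  The blow-up is the zero set of \<open>c \<bullet> y\<^sub>H + r q y\<close>.  On a ball its points are moved into the
  hyperplane by a projection that does not leave the ball; conversely the intermediate value theorem on lines
  in the direction \<open>transversal c\<close> finds points of the blow-up near those of the hyperplane.
\<close>

lemma tangent_group_at_regular_point:
  fixes z :: "'n::finite heis"
  assumes Q: "transpose Q = Q" and z: "z \<in> quadric b Q T" and c: "quadric_hgrad b Q T z \<noteq> 0"
  shows "is_tangent_group (quadric b Q T) z (vertical_hyperplane (quadric_hgrad b Q T z))"
  unfolding is_tangent_group_def
proof (intro conjI exI[of _ "quadric_hgrad b Q T z"] allI impI)
  fix R :: real assume R: "R > 0"
  define c where "c = quadric_hgrad b Q T z"
  have c0: "c \<noteq> 0" using c by (simp add: c_def)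
  let ?e = "transversal c"
  let ?q = "quadric_fun 0 Q T"
  obtain C where C: "C > 0" "\<And>y. koranyi_norm y \<le> R \<Longrightarrow> \<bar>?q y\<bar> \<le> C"
    using quadric_fun_bounded[of R 0 Q T] by blast
  show "((\<lambda>r. koranyi_hausdist (blowup (quadric b Q T) z r \<inter> koranyi_ball 0 R)
      (vertical_hyperplane (quadric_hgrad b Q T z) \<inter> koranyi_ball 0 R)) \<longlongrightarrow> 0) (at_right 0)"
    unfolding c_def[symmetric]
  proof (rule tendsto_0_at_right_ennreal)
    fix \<epsilon> :: real assume \<epsilon>: "\<epsilon> > 0"
    have "\<exists>a>0. \<forall>w s. koranyi_norm (w::'n heis) \<le> R \<longrightarrow> \<bar>s\<bar> \<le> a \<longrightarrow> koranyi_dist w (heis_dil (1 - s) w) \<le> \<epsilon> / 2"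
      by (rule koranyi_dist_uniformly_small) (use \<epsilon> in \<open>auto simp: case_prod_beta' intro!: continuous_intros\<close>)
    then obtain a0 where a0: "a0 > 0" "\<And>w s. koranyi_norm (w::'n heis) \<le> R \<Longrightarrow> \<bar>s\<bar> \<le> a0 \<Longrightarrow>
        koranyi_dist w (heis_dil (1 - s) w) \<le> \<epsilon> / 2" by blast
    define \<theta> where "\<theta> = min a0 (1/2)"
    have \<theta>: "\<theta> > 0" "\<theta> < 1" "\<bar>\<theta>\<bar> \<le> a0" using a0 by (auto simp: \<theta>_def)
    have "min (\<epsilon> / 2) (\<theta> * R) > 0" using \<epsilon> \<theta> R by simp
    then obtain a where a: "a > 0" "\<And>w s. koranyi_norm w \<le> R \<Longrightarrow> \<bar>s\<bar> \<le> a \<Longrightarrow>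
        koranyi_dist w (w + s *\<^sub>R ?e) \<le> min (\<epsilon> / 2) (\<theta> * R)"
      using koranyi_dist_shift_small by blast
    have "koranyi_hausdist (blowup (quadric b Q T) z r \<inter> koranyi_ball 0 R)
        (vertical_hyperplane c \<inter> koranyi_ball 0 R) \<le> ennreal \<epsilon>" if r: "0 < r" "r < a / C" for r
    proof -
      have rC: "r * C \<le> a" using r C by (simp add: pos_less_divide_eq)
      have rq: "\<bar>r * ?q y\<bar> \<le> a" if "koranyi_norm y \<le> R" for y
      proof -
        have "r * \<bar>?q y\<bar> \<le> r * C" using r by (intro mult_left_mono C(2)[OF that]) simp
        moreover have "\<bar>r * ?q y\<bar> = r * \<bar>?q y\<bar>" using r by (simp add: abs_mult)
        ultimately show ?thesis using rC by linarith
      qed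
      have bl: "y \<in> blowup (quadric b Q T) z r \<longleftrightarrow> c \<bullet> fst y + r * ?q y = 0" for y
        using mem_blowup_quadric[OF Q r(1) z] by (simp add: c_def)
      show ?thesis unfolding koranyi_hausdist_def
      proof (rule max.boundedI; rule koranyi_excess_le)
        fix y assume y: "y \<in> blowup (quadric b Q T) z r \<inter> koranyi_ball 0 R"
        then have yR: "koranyi_norm y \<le> R" by (simp add: mem_koranyi_ball)
        have "c \<bullet> fst y + r * ?q y = 0" using y bl by blast
        then have "\<bar>- (c \<bullet> fst y)\<bar> \<le> a" using rq[OF yR] by linarith
        then have "koranyi_dist y (plane_proj c y) \<le> \<epsilon>"
          using a(2)[OF yR, of "- (c \<bullet> fst y)"] \<epsilon> by (simp add: plane_proj_def)
        moreover have "plane_proj c y \<in> vertical_hyperplane c \<inter> koranyi_ball 0 R"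
          using plane_proj_in[OF c0] order_trans[OF koranyi_norm_plane_proj yR]
          by (simp add: vertical_hyperplane_def mem_koranyi_ball)
        ultimately show "\<exists>w\<in>vertical_hyperplane c \<inter> koranyi_ball 0 R. koranyi_dist y w \<le> \<epsilon>" by blast
      next
        fix w assume "w \<in> vertical_hyperplane c \<inter> koranyi_ball 0 R"
        then have wR: "koranyi_norm w \<le> R" and cw: "c \<bullet> fst w = 0"
          by (simp_all add: mem_koranyi_ball vertical_hyperplane_def)
        \<comment> \<open>Shrinking \<open>w\<close> first leaves room in the ball for the correction along \<open>?e\<close>.\<close>
        define w' where "w' = heis_dil (1 - \<theta>) w"
        have w'R: "koranyi_norm w' \<le> (1 - \<theta>) * R"
          using \<theta> wR by (simp add: w'_def koranyi_norm_dil)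
        moreover have "(1 - \<theta>) * R \<le> R" using \<theta> R by (simp add: mult_le_cancel_right1)
        ultimately have w'R': "koranyi_norm w' \<le> R" by linarith
        have ww': "koranyi_dist w w' \<le> \<epsilon> / 2"
          unfolding w'_def by (rule a0(2)[OF wR \<theta>(3)])
        have N: "koranyi_norm (w' + s *\<^sub>R ?e) \<le> R" if "\<bar>s\<bar> \<le> a" for s
          using a(2)[OF w'R' that] w'R koranyi_norm_le_dist[of "w' + s *\<^sub>R ?e" w']
          by (simp add: algebra_simps)
        define h where "h s = s + r * ?q (w' + s *\<^sub>R ?e)" for s
        have "continuous_on {-a..a} h" unfolding h_def by (intro continuous_intros)
        moreover have "h (- a) \<le> 0" "0 \<le> h a"
          using rq[OF N[of a]] rq[OF N[of "- a"]] a(1) by (auto simp: h_def)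
        ultimately obtain s where s: "- a \<le> s" "s \<le> a" "h s = 0"
          using IVT'[of h "- a" 0 a] a(1) by auto
        then have sa: "\<bar>s\<bar> \<le> a" by simp
        have "c \<bullet> fst w' = 0" using cw by (simp add: w'_def fst_heis_dil)
        then have "w' + s *\<^sub>R ?e \<in> blowup (quadric b Q T) z r"
          unfolding bl using s(3) inner_transversal[OF c0] by (simp add: h_def inner_simps)
        moreover have "koranyi_dist w (w' + s *\<^sub>R ?e) \<le> \<epsilon>"
          using koranyi_dist_triangle[of w "w' + s *\<^sub>R ?e" w'] a(2)[OF w'R' sa] ww' by simp
        ultimately show "\<exists>y\<in>blowup (quadric b Q T) z r \<inter> koranyi_ball 0 R. koranyi_dist w y \<le> \<epsilon>"
          using N[OF sa] by (auto simp: mem_koranyi_ball)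
      qed
    qed
    then show "\<exists>\<beta>>0. \<forall>r. 0 < r \<longrightarrow> r < \<beta> \<longrightarrow> koranyi_hausdist (blowup (quadric b Q T) z r \<inter> koranyi_ball 0 R)
        (vertical_hyperplane c \<inter> koranyi_ball 0 R) \<le> ennreal \<epsilon>"
      using a(1) C(1) by (intro exI[of _ "a / C"]) simp
  qed
qed (use z c in auto)

text \<open>
  At a characteristic point all the blow-ups are the same cone, so a limit in the Hausdorff distance
  must be equal to it.
\<close>

lemma tangent_group_at_characteristic_point:
  fixes z :: "'n::finite heis"
  assumes Q: "transpose Q = Q" and c: "quadric_hgrad b Q T z = 0"
    and tg: "is_tangent_group (quadric b Q T) z W"
  shows "\<exists>v. v \<noteq> 0 \<and> (\<forall>y. quadric_fun 0 Q T y = 0 \<longleftrightarrow> v \<bullet> fst y = 0)"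
proof -
  obtain v where z: "z \<in> quadric b Q T" and v: "v \<noteq> 0" and W: "W = vertical_hyperplane v"
    and lim: "\<And>R. R > 0 \<Longrightarrow> ((\<lambda>r. koranyi_hausdist (blowup (quadric b Q T) z r \<inter> koranyi_ball 0 R)
       (W \<inter> koranyi_ball 0 R)) \<longlongrightarrow> 0) (at_right 0)"
    using tg unfolding is_tangent_group_def by blast
  define K0 where "K0 = {y. quadric_fun 0 Q T y = 0}"
  have bl: "blowup (quadric b Q T) z r = K0" if "r > 0" for r
    using mem_blowup_quadric[OF Q that z] that c by (auto simp: K0_def)
  have "closed K0" unfolding K0_def by (intro closed_Collect_eq continuous_intros)
  moreover have "closed W"
    unfolding W vertical_hyperplane_def by (intro closed_Collect_eq continuous_intros)
  ultimately have cl: "closed (K0 \<inter> koranyi_ball 0 R)" "closed (W \<inter> koranyi_ball 0 R)" for R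
    by (auto intro: closed_koranyi_ball)
  have eq: "K0 \<inter> koranyi_ball 0 R = W \<inter> koranyi_ball 0 R" if R: "R > 0" for R
  proof -
    let ?H = "koranyi_hausdist (K0 \<inter> koranyi_ball 0 R) (W \<inter> koranyi_ball 0 R)"
    have "\<forall>\<^sub>F r in at_right 0. r > (0::real)" by (simp add: eventually_at_right_less)
    then have "\<forall>\<^sub>F r in at_right 0. koranyi_hausdist (blowup (quadric b Q T) z r \<inter> koranyi_ball 0 R)
       (W \<inter> koranyi_ball 0 R) = ?H"
      by eventually_elim (simp add: bl)
    then have "((\<lambda>r::real. ?H) \<longlongrightarrow> 0) (at_right 0)"
      using lim[OF R] by (rule Lim_transform_eventually[rotated])
    then have "?H = 0" by (simp add: tendsto_const_iff)
    then have "koranyi_excess (K0 \<inter> koranyi_ball 0 R) (W \<inter> koranyi_ball 0 R) = 0"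
      "koranyi_excess (W \<inter> koranyi_ball 0 R) (K0 \<inter> koranyi_ball 0 R) = 0"
      unfolding koranyi_hausdist_def by (metis max.cobounded1 max.cobounded2 le_zero_eq)+
    then show ?thesis using koranyi_excess_0_subset cl by (intro equalityI) blast+
  qed
  have "y \<in> K0 \<longleftrightarrow> y \<in> W" for y
  proof -
    have "y \<in> koranyi_ball 0 (koranyi_norm y + 1)" "koranyi_norm y + 1 > 0"
      by (simp_all add: mem_koranyi_ball add_nonneg_pos)
    then show ?thesis using eq by blast
  qed
  then show ?thesis using v by (intro exI[of _ v]) (auto simp: K0_def W vertical_hyperplane_def)
qed

section \<open>Uniform measures and Fubini's theorem for Koranyi balls\<close>

lemma closed_msupport: "closed (msupport \<mu>)"
proof -
  have "- msupport \<mu> = \<Union>{U. open U \<and> emeasure \<mu> U = 0}"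
    by (auto simp: msupport_def)
  then show ?thesis by (metis (no_types, lifting) closed_def mem_Collect_eq open_Union)
qed

lemma AE_msupport:
  fixes \<mu> :: "'a::second_countable_topology measure"
  assumes s: "sets \<mu> = sets borel"
  shows "AE x in \<mu>. x \<in> msupport \<mu>"
proof -
  define F where "F = {U. open U \<and> emeasure \<mu> U = 0}"
  have op: "\<And>U. U \<in> F \<Longrightarrow> open U" by (simp add: F_def)
  obtain F' where F': "F' \<subseteq> F" "countable F'" "\<Union>F' = \<Union>F"
    by (rule Lindelof[of F, OF op])
  have "(\<Union>U\<in>F'. U) \<in> null_sets \<mu>"
  proof (rule null_sets_UN'[OF F'(2)])
    fix U assume "U \<in> F'"
    then have "open U" "emeasure \<mu> U = 0" using F'(1) by (auto simp: F_def)
    then show "U \<in> null_sets \<mu>" by (simp add: null_sets_def s)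
  qed
  moreover have "{x \<in> space \<mu>. x \<notin> msupport \<mu>} \<subseteq> (\<Union>U\<in>F'. U)"
    using F'(3) by (auto simp: msupport_def F_def)
  ultimately show ?thesis by (rule AE_I')
qed

lemma sigma_finite_radon:
  fixes \<mu> :: "'a::euclidean_space measure"
  assumes "radon_measure \<mu>"
  shows "sigma_finite_measure \<mu>"
proof
  have s: "sets \<mu> = sets borel" and K: "\<And>K. compact K \<Longrightarrow> emeasure \<mu> K < \<infinity>"
    using assms by (auto simp: radon_measure_def)
  have "space \<mu> = UNIV" using sets_eq_imp_space_eq[OF s] by simp
  moreover have "(\<Union>n::nat. cball (0::'a) (real n)) = UNIV"
    by (auto simp: real_arch_simple)
  ultimately show "\<exists>A. countable A \<and> A \<subseteq> sets \<mu> \<and> \<Union>A = space \<mu> \<and> (\<forall>a\<in>A. emeasure \<mu> a \<noteq> \<infinity>)"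
    using K by (intro exI[of _ "range (\<lambda>n::nat. cball 0 (real n))"])
      (auto simp: s less_top[symmetric] top_unique)
qed

text \<open>
  Both sides are the \<open>\<mu> \<times> \<nu>\<close>-measure of the pairs in \<open>A \<times> B\<close> at distance at most \<open>r\<close>.
\<close>

lemma fubini_koranyi_balls:
  fixes \<mu> \<nu> :: "'n::finite heis measure"
  assumes s [measurable_cong]: "sets \<mu> = sets borel" "sets \<nu> = sets borel"
    and sf: "sigma_finite_measure \<mu>" "sigma_finite_measure \<nu>"
    and [measurable]: "A \<in> sets borel" "B \<in> sets borel"
  shows "(\<integral>\<^sup>+x. indicator A x * emeasure \<nu> ({y. koranyi_dist x y \<le> r} \<inter> B) \<partial>\<mu>)
    = (\<integral>\<^sup>+y. indicator B y * emeasure \<mu> ({x. koranyi_dist y x \<le> r} \<inter> A) \<partial>\<nu>)"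
proof -
  interpret pair_sigma_finite \<mu> \<nu> using sf by (simp add: pair_sigma_finite_def)
  define G :: "'n heis \<times> 'n heis \<Rightarrow> ennreal" where
    "G z = indicator A (fst z) * (indicator B (snd z) * indicator {z. koranyi_dist (fst z) (snd z) \<le> r} z)" for z
  have "sets (\<mu> \<Otimes>\<^sub>M \<nu>) = sets (borel \<Otimes>\<^sub>M borel)" by (rule sets_pair_measure_cong[OF s])
  moreover have "G \<in> borel_measurable (borel \<Otimes>\<^sub>M borel)"
  proof -
    have "{z. koranyi_dist (fst z) (snd z) \<le> r} \<in> sets (borel \<Otimes>\<^sub>M (borel :: 'n heis measure))"
      unfolding borel_prod by (intro borel_closed closed_Collect_le continuous_intros)
    then show ?thesis unfolding G_def by measurable
  qed
  ultimately have G: "G \<in> borel_measurable (\<mu> \<Otimes>\<^sub>M \<nu>)" using measurable_cong_sets by blast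
  have 1: "(\<integral>\<^sup>+y. G (x, y) \<partial>\<nu>) = indicator A x * emeasure \<nu> ({y. koranyi_dist x y \<le> r} \<inter> B)" for x
  proof -
    have "(\<integral>\<^sup>+y. G (x, y) \<partial>\<nu>) = (\<integral>\<^sup>+y. indicator A x * indicator ({y. koranyi_dist x y \<le> r} \<inter> B) y \<partial>\<nu>)"
      by (rule nn_integral_cong) (auto simp: G_def indicator_def)
    also have "\<dots> = indicator A x * emeasure \<nu> ({y. koranyi_dist x y \<le> r} \<inter> B)"
      by (rule nn_integral_cmult_indicator) measurable
    finally show ?thesis .
  qed
  have 2: "(\<integral>\<^sup>+x. G (x, y) \<partial>\<mu>) = indicator B y * emeasure \<mu> ({x. koranyi_dist y x \<le> r} \<inter> A)" for y
  proof -
    have "(\<integral>\<^sup>+x. G (x, y) \<partial>\<mu>) = (\<integral>\<^sup>+x. indicator B y * indicator ({x. koranyi_dist y x \<le> r} \<inter> A) x \<partial>\<mu>)"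
      by (rule nn_integral_cong) (auto simp: G_def indicator_def koranyi_dist_sym)
    also have "\<dots> = indicator B y * emeasure \<mu> ({x. koranyi_dist y x \<le> r} \<inter> A)"
      by (rule nn_integral_cmult_indicator) measurable
    finally show ?thesis .
  qed
  have "(\<integral>\<^sup>+y. \<integral>\<^sup>+x. G (x, y) \<partial>\<mu> \<partial>\<nu>) = (\<integral>\<^sup>+x. \<integral>\<^sup>+y. G (x, y) \<partial>\<nu> \<partial>\<mu>)"
    by (rule Fubini[OF G])
  then show ?thesis by (simp add: 1 2)
qed

definition koranyi_setdist :: "'n::finite heis set \<Rightarrow> 'n heis \<Rightarrow> real" where
  "koranyi_setdist S z = (INF s\<in>S. koranyi_dist z s)"

lemma koranyi_setdist_le: "s \<in> S \<Longrightarrow> koranyi_setdist S z \<le> koranyi_dist z s"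
  unfolding koranyi_setdist_def by (rule cINF_lower) (auto intro: bdd_belowI2[of _ 0])

lemma koranyi_setdist_less: "S \<noteq> {} \<Longrightarrow> koranyi_setdist S z < r \<Longrightarrow> \<exists>s\<in>S. koranyi_dist z s < r"
  unfolding koranyi_setdist_def by (subst (asm) cINF_less_iff) (auto intro: bdd_belowI2[of _ 0])

lemma koranyi_setdist_triangle:
  assumes "S \<noteq> {}"
  shows "koranyi_setdist S z \<le> koranyi_dist z z' + koranyi_setdist S z'"
proof -
  have "koranyi_setdist S z - koranyi_dist z z' \<le> koranyi_setdist S z'"
    unfolding koranyi_setdist_def[of S z']
  proof (rule cINF_greatest[OF assms])
    fix s assume "s \<in> S"
    then show "koranyi_setdist S z - koranyi_dist z z' \<le> koranyi_dist z' s"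
      using koranyi_setdist_le[of s S z] koranyi_dist_triangle[of z s z'] by simp
  qed
  then show ?thesis by simp
qed

lemma koranyi_setdist_pos:
  assumes "closed S" "S \<noteq> {}" "z \<notin> S"
  shows "koranyi_setdist S z > 0"
proof -
  obtain \<epsilon> where \<epsilon>: "\<epsilon> > 0" "\<forall>x. koranyi_dist z x < \<epsilon> \<longrightarrow> x \<in> - S"
    using koranyi_ball_open_nbhd[of "- S" z] assms by (auto simp: open_closed)
  have "\<epsilon> \<le> koranyi_setdist S z"
    unfolding koranyi_setdist_def by (rule cINF_greatest[OF assms(2)]) (use \<epsilon> in force)
  then show ?thesis using \<epsilon> by simp
qed

lemma measurable_koranyi_setdist [measurable]: "koranyi_setdist S \<in> borel_measurable borel"
proof (cases "S = {}")
  case True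
  then have "koranyi_setdist S = (\<lambda>_. Inf {})" by (simp add: koranyi_setdist_def fun_eq_iff)
  then show ?thesis by simp
next
  case False
  have "isCont (koranyi_setdist S) z" for z
  proof -
    have "continuous_on UNIV (koranyi_dist z)" by (intro continuous_intros)
    then have "isCont (koranyi_dist z) z"
      using continuous_on_eq_continuous_at[OF open_UNIV] by blast
    then have "((\<lambda>z'. koranyi_dist z z') \<longlongrightarrow> koranyi_dist z z) (at z)"
      unfolding isCont_def .
    then have "((\<lambda>z'. koranyi_dist z z') \<longlongrightarrow> 0) (at z)" by simp
    then have "((\<lambda>z'. koranyi_setdist S z' - koranyi_setdist S z) \<longlongrightarrow> 0) (at z)"
    proof (rule Lim_null_comparison[rotated], intro always_eventually allI)
      fix z'
      show "norm (koranyi_setdist S z' - koranyi_setdist S z) \<le> koranyi_dist z z'"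
        using koranyi_setdist_triangle[OF False, of z z'] koranyi_setdist_triangle[OF False, of z' z]
        by (simp add: koranyi_dist_sym[of z' z] abs_le_iff)
    qed
    then show ?thesis unfolding isCont_def by (rule LIM_zero_cancel)
  qed
  then have "continuous_on UNIV (koranyi_setdist S)" by (simp add: continuous_on_eq_continuous_at)
  then show ?thesis by (rule borel_measurable_continuous_onI)
qed

lemma uniformD:
  fixes \<mu> :: "'n::finite heis measure"
  assumes "codim1_uniform \<mu>"
  shows "sets \<mu> = sets borel" "sigma_finite_measure \<mu>" "0 \<in> msupport \<mu>"
    "\<And>x r. x \<in> msupport \<mu> \<Longrightarrow> r > 0 \<Longrightarrow> emeasure \<mu> {z. koranyi_dist x z \<le> r} = ennreal (r ^ (2 * CARD('n) + 1))"
proof -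
  show "sets \<mu> = sets borel" "sigma_finite_measure \<mu>" "0 \<in> msupport \<mu>"
    using assms sigma_finite_radon by (auto simp: codim1_uniform_def radon_measure_def)
  fix x r assume "x \<in> msupport \<mu>" "(r::real) > 0"
  moreover have "{z. koranyi_dist x z \<le> r} = koranyi_ball x r"
    by (auto simp: mem_koranyi_ball)
  ultimately show "emeasure \<mu> {z. koranyi_dist x z \<le> r} = ennreal (r ^ (2 * CARD('n) + 1))"
    using assms by (simp add: codim1_uniform_def)
qed

text \<open>
  Uniformity controls the balls centred on the support; a ball centred near the support lies in a
  slightly larger one of these.
\<close>

lemma uniform_ball_le:
  fixes \<mu> :: "'n::finite heis measure"
  assumes u: "codim1_uniform \<mu>" and d: "koranyi_setdist (msupport \<mu>) y < t" and r: "r > 0"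
  shows "emeasure \<mu> {z. koranyi_dist y z \<le> r} \<le> ennreal ((r + t) ^ (2 * CARD('n) + 1))"
proof -
  have ne: "msupport \<mu> \<noteq> {}" using uniformD(3)[OF u] by auto
  obtain s where s: "s \<in> msupport \<mu>" "koranyi_dist y s < t" using koranyi_setdist_less[OF ne d] by blast
  then have t: "t > 0" using koranyi_dist_nonneg[of y s] by linarith
  have "emeasure \<mu> {z. koranyi_dist y z \<le> r} \<le> emeasure \<mu> {z. koranyi_dist s z \<le> r + t}"
  proof (rule emeasure_mono)
    show "{z. koranyi_dist y z \<le> r} \<subseteq> {z. koranyi_dist s z \<le> r + t}"
    proof clarsimp
      fix z assume "koranyi_dist y z \<le> r"
      then show "koranyi_dist s z \<le> r + t"
        using koranyi_dist_triangle[of s z y] s(2) koranyi_dist_sym[of s y] by simp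
    qed
    show "{z. koranyi_dist s z \<le> r + t} \<in> sets \<mu>" unfolding uniformD(1)[OF u] by measurable
  qed
  also have "\<dots> = ennreal ((r + t) ^ (2 * CARD('n) + 1))"
    using r t by (intro uniformD(4)[OF u s(1)]) simp
  finally show ?thesis .
qed

lemma uniform_ball_far:
  fixes \<mu> :: "'n::finite heis measure"
  assumes u: "codim1_uniform \<mu>" and d: "r < koranyi_setdist (msupport \<mu>) y"
  shows "emeasure \<mu> {z. koranyi_dist y z \<le> r} = 0"
proof -
  have "AE z in \<mu>. z \<notin> {z. koranyi_dist y z \<le> r}"
    using AE_msupport[OF uniformD(1)[OF u]]
  proof eventually_elim
    fix z assume "z \<in> msupport \<mu>"
    from koranyi_setdist_le[OF this, of y] show "z \<notin> {z. koranyi_dist y z \<le> r}" using d by simp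
  qed
  moreover have "{z. koranyi_dist y z \<le> r} \<in> sets \<mu>" unfolding uniformD(1)[OF u] by measurable
  ultimately have "{z. koranyi_dist y z \<le> r} \<in> null_sets \<mu>" by (simp only: AE_iff_null_sets)
  then show ?thesis by (rule null_setsD1)
qed

section \<open>The support has no holes at a regular point\<close>

text \<open>
  The constant for the contradiction in \<open>support_contains_neighbourhood\<close>: at \<open>\<tau> = 0\<close> the left side is
  \<open>1 - 1 / 6 ^ m\<close>, where \<open>1 / 6 ^ m\<close> is the relative area of a hole of radius \<open>R / 6\<close> in a ball
  of radius \<open>R\<close>.
\<close>

lemma scale_constant:
  "\<exists>\<tau>::real. 0 < \<tau> \<and> \<tau> \<le> 1/6 \<and>
     (1 + 2 * \<tau>) ^ m * ((1 + \<tau>) * (1 + \<tau>) ^ m - (1 - \<tau>) / 6 ^ m) + 3 ^ m * (\<tau> * (1 + \<tau>) * 2 ^ m) < 1 - \<tau>"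
proof -
  define F where "F \<tau> = (1 + 2 * \<tau>) ^ m * ((1 + \<tau>) * (1 + \<tau>) ^ m - (1 - \<tau>) / 6 ^ m)
     + 3 ^ m * (\<tau> * (1 + \<tau>) * 2 ^ m) + \<tau>" for \<tau> :: real
  have "isCont F 0" unfolding F_def by (intro continuous_intros) simp
  then have "(F \<longlongrightarrow> F 0) (at_right 0)"
    by (simp add: isCont_def filterlim_at_split)
  moreover have "F 0 < 1" by (simp add: F_def)
  ultimately have "\<forall>\<^sub>F \<tau> in at_right 0. F \<tau> < 1" by (rule order_tendstoD(2))
  moreover have "\<forall>\<^sub>F \<tau> in at_right (0::real). 0 < \<tau> \<and> \<tau> < 1/6"
    unfolding eventually_at_right_field by (intro exI[of _ "1/6"]) auto
  ultimately have "\<forall>\<^sub>F \<tau> in at_right 0. F \<tau> < 1 \<and> 0 < \<tau> \<and> \<tau> < 1/6"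
    by (rule eventually_conj)
  then obtain \<tau> where "F \<tau> < 1" "0 < \<tau>" "\<tau> < 1/6"
    using eventually_happens' trivial_limit_at_right_real by blast
  then show ?thesis by (intro exI[of _ \<tau>]) (simp add: F_def)
qed

lemma small_member_of_sum:
  fixes a :: "nat \<Rightarrow> real"
  assumes "(\<Sum>k<N. a k) \<le> V" "1 \<le> real N * \<tau>" "N \<ge> 1" "V \<ge> 0"
  shows "\<exists>k<N. a k \<le> \<tau> * V"
proof (rule ccontr)
  assume "\<not> ?thesis"
  then have "(\<Sum>k<N. \<tau> * V) < (\<Sum>k<N. a k)"
    using assms(3) by (intro sum_strict_mono) (auto simp: not_le lessThan_empty_iff)
  moreover have "V \<le> real N * \<tau> * V" using assms(2,4) mult_right_mono[of 1 "real N * \<tau>" V] by simp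
  ultimately show False using assms(1) by simp
qed

text \<open>
  Suppose that \<open>y\<close> in the quadric has distance \<open>d > 0\<close> from the support, and take \<open>x\<close> in the support
  with \<open>d(y, x) < 2 d\<close>.  The double integral over the ball of radius \<open>R = 3 d\<close> about \<open>x\<close> and the slab
  \<open>A\<close> around the quadric is evaluated at the scales \<open>r k\<close>.  It is at least almost
  \<open>U (r k)\<^sup>m R\<^sup>m\<close> when \<open>\<mu>\<close> is the outer measure.  When Lebesgue measure is the outer one, the points of \<open>A\<close> are sorted by their distance
  \<open>D\<close> from the support: up to \<open>\<tau> r k\<close> (\<open>near\<close>) they see at most \<open>((1 + 2 \<tau>) r k)\<^sup>m\<close>, beyond \<open>r k\<close> they
  see nothing, and in between (\<open>mid\<close>) they see at most \<open>(3 r k)\<^sup>m\<close>.  The set \<open>near k\<close> avoids the hole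
  about \<open>y\<close>, and the sets \<open>mid k\<close> are disjoint, so that one of them is negligible.
\<close>

lemma support_contains_neighbourhood:
  fixes \<mu> :: "'n::finite heis measure"
  assumes u: "codim1_uniform \<mu>" and Q: "transpose Q = Q"
    and sub: "msupport \<mu> \<subseteq> quadric b Q T" and p: "p \<in> msupport \<mu>"
    and c: "quadric_hgrad b Q T p \<noteq> 0"
  shows "\<exists>\<rho>>0. \<forall>y\<in>quadric b Q T. koranyi_dist p y < \<rho> \<longrightarrow> y \<in> msupport \<mu>"
proof -
  define S where "S = msupport \<mu>"
  define m where "m = 2 * CARD('n) + 1"
  define w where "w = plane_area (quadric_hgrad b Q T p)"
  have w: "w > 0" unfolding w_def by (rule plane_area(1)[OF c])
  obtain \<tau> :: real where \<tau>: "0 < \<tau>" "\<tau> \<le> 1/6" and \<tau>m: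
     "(1 + 2 * \<tau>) ^ m * ((1 + \<tau>) * (1 + \<tau>) ^ m - (1 - \<tau>) / 6 ^ m) + 3 ^ m * (\<tau> * (1 + \<tau>) * 2 ^ m) < 1 - \<tau>"
    using scale_constant[of m] by blast
  have \<tau>1: "\<tau> < 1" using \<tau> by simp
  note estimate = quadric_ball_measure[OF Q c \<tau>(1) \<tau>1, folded w_def m_def]
  obtain \<rho> \<kappa> where \<rho>: "\<rho> > 0" and \<kappa>: "\<kappa> > 0" and ball: "\<forall>x r \<delta>. x \<in> quadric b Q T \<longrightarrow>
      koranyi_dist p x < \<rho> \<longrightarrow> 0 < r \<longrightarrow> r \<le> \<rho> \<longrightarrow> 0 < \<delta> \<longrightarrow> \<delta> \<le> \<kappa> * r \<longrightarrow>
     ennreal ((1 - \<tau>) * (2 * \<delta> * w * r ^ m))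
       \<le> emeasure lborel {z. koranyi_dist x z \<le> r \<and> \<bar>quadric_fun b Q T z\<bar> < \<delta>} \<and>
     emeasure lborel {z. koranyi_dist x z \<le> r \<and> \<bar>quadric_fun b Q T z\<bar> < \<delta>}
       \<le> ennreal ((1 + \<tau>) * (2 * \<delta> * w * r ^ m))"
    using estimate by (elim exE conjE) (rule that)
  have clS: "closed S" unfolding S_def by (rule closed_msupport)
  have neS: "S \<noteq> {}" using p by (auto simp: S_def)
  have SK: "S \<subseteq> quadric b Q T" using sub by (simp add: S_def)
  have "y \<in> S" if y: "y \<in> quadric b Q T" "koranyi_dist p y < \<rho> / 8" for y
  proof (rule ccontr)
    assume yS: "y \<notin> S"
    define D where "D = koranyi_setdist S"
    define d where "d = D y"
    have d: "d > 0" unfolding d_def D_def by (rule koranyi_setdist_pos[OF clS neS yS])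
    have d\<rho>: "d < \<rho> / 8"
      using koranyi_setdist_le[of p S y] p y(2) by (simp add: d_def D_def S_def koranyi_dist_sym)
    obtain x where x: "x \<in> S" "koranyi_dist y x < 2 * d"
      using koranyi_setdist_less[OF neS, of y "2 * d"] d by (auto simp: d_def D_def)
    define R where "R = 3 * d"
    have R: "R > 0" "d / 2 = R / 6" using d by (simp_all add: R_def)
    have px: "koranyi_dist p x < 3 * \<rho> / 8"
      using koranyi_dist_triangle[of p x y] x(2) y(2) d\<rho> by simp
    obtain N :: nat where N: "1 \<le> real N * \<tau>"
      using ex_less_of_nat_mult[OF \<tau>(1), of 1] by (meson less_imp_le)
    have N1: "N \<ge> 1" using N by (cases N) auto
    define r where "r k = \<tau> ^ Suc k * R" for k
    \<comment> \<open>The slab must be thin compared with the smallest of the scales, so that the volume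
      estimate is valid at all of them.\<close>
    define \<delta> where "\<delta> = \<kappa> * (\<tau> ^ N * R)"
    have \<delta>: "\<delta> > 0" using \<kappa> \<tau> R by (simp add: \<delta>_def)
    define U where "U = 2 * \<delta> * w"
    have U: "U > 0" using \<delta> w by (simp add: U_def)
    have r0: "r k > 0" for k using \<tau> R by (simp add: r_def)
    have rN: "\<tau> ^ N * R \<le> r k" if "k < N" for k
      unfolding r_def using that \<tau> R(1) by (intro mult_right_mono power_decreasing) auto
    have rR: "r k \<le> \<tau> * R" for k
    proof -
      have "\<tau> ^ Suc k \<le> \<tau> ^ 1" using \<tau> by (intro power_decreasing) auto
      then show ?thesis unfolding r_def using R(1) by (intro mult_right_mono) auto
    qed
    have \<tau>R: "\<tau> * R \<le> R / 6" using \<tau> R(1) mult_right_mono[of \<tau> "1/6" R] by simp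
    have r\<tau>: "r k \<le> \<tau> * r j" if "j < k" for j k
    proof -
      have "\<tau> ^ Suc k \<le> \<tau> ^ Suc (Suc j)" using \<tau> that by (intro power_decreasing) auto
      then have "\<tau> ^ Suc k * R \<le> \<tau> ^ Suc (Suc j) * R" using R(1) by (intro mult_right_mono) auto
      then show ?thesis by (simp add: r_def mult.assoc)
    qed
    define A where "A = {z. \<bar>quadric_fun b Q T z\<bar> < \<delta>}"
    have A [measurable]: "A \<in> sets borel" unfolding A_def by measurable
    have vol: "ennreal ((1 - \<tau>) * (U * s ^ m)) \<le> emeasure lborel ({z. koranyi_dist x' z \<le> s} \<inter> A)"
      "emeasure lborel ({z. koranyi_dist x' z \<le> s} \<inter> A) \<le> ennreal ((1 + \<tau>) * (U * s ^ m))"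
      if "x' \<in> quadric b Q T" "koranyi_dist p x' < \<rho>" "s \<le> \<rho>" "\<tau> ^ N * R \<le> s" for x' s
    proof -
      have "0 < \<tau> ^ N * R" using \<tau> R(1) by simp
      then have s: "0 < s" using that by linarith
      have "\<delta> \<le> \<kappa> * s" unfolding \<delta>_def using that \<kappa> by (intro mult_left_mono) auto
      note B = ball[rule_format, OF that(1,2) s that(3) \<delta> this]
      have "{z. koranyi_dist x' z \<le> s \<and> \<bar>quadric_fun b Q T z\<bar> < \<delta>} = {z. koranyi_dist x' z \<le> s} \<inter> A"
        by (auto simp: A_def)
      then show "ennreal ((1 - \<tau>) * (U * s ^ m)) \<le> emeasure lborel ({z. koranyi_dist x' z \<le> s} \<inter> A)"
        "emeasure lborel ({z. koranyi_dist x' z \<le> s} \<inter> A) \<le> ennreal ((1 + \<tau>) * (U * s ^ m))"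
        using B by (simp_all only: U_def)
    qed
    have xK: "x \<in> quadric b Q T" using x SK by auto
    have R\<rho>: "2 * R \<le> \<rho>" using d\<rho> d by (simp add: R_def)
    have tNR: "\<tau> ^ N * R \<le> R / 6"
      using rN[of 0] rR[of 0] \<tau>R N1 by simp
    define BB where "BB = {z. koranyi_dist x z \<le> 2 * R} \<inter> A"
    define near where "near k = {z. koranyi_dist x z \<le> R + r k \<and> D z \<le> \<tau> * r k} \<inter> A" for k
    define mid where "mid k = {z. koranyi_dist x z \<le> 2 * R \<and> \<tau> * r k < D z \<and> D z \<le> r k} \<inter> A" for k
    define hole where "hole = {z. koranyi_dist y z \<le> d / 2} \<inter> A"
    have Dm [measurable]: "D \<in> borel_measurable borel" unfolding D_def by measurable
    have meas [measurable]: "BB \<in> sets borel" "near k \<in> sets borel" "mid k \<in> sets borel" "hole \<in> sets borel" for k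
      unfolding BB_def near_def mid_def hole_def by measurable
    have BB: "emeasure lborel BB \<le> ennreal ((1 + \<tau>) * (U * (2 * R) ^ m))"
      unfolding BB_def by (rule vol(2)[OF xK]) (use px R\<rho> tNR R(1) \<rho> in auto)
    have rR1: "r k \<le> R" for k using rR[of k] \<tau>R R(1) by linarith
    have fin: "emeasure lborel X < \<infinity>" if "X \<subseteq> BB" "X \<in> sets borel" for X
    proof -
      have "emeasure lborel X \<le> emeasure lborel BB" using that by (intro emeasure_mono) auto
      also have "\<dots> < \<infinity>" using BB by (rule order.strict_trans1) simp
      finally show ?thesis .
    qed
    have holeR: "koranyi_dist x z \<le> R" if "z \<in> hole" for z
      using that koranyi_dist_triangle[of x z y] x(2) d by (simp add: hole_def R_def koranyi_dist_sym[of x y])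
    have subs: "near k \<subseteq> BB" "mid k \<subseteq> BB" "hole \<subseteq> BB" for k
    proof -
      have "koranyi_dist x z \<le> 2 * R" if "z \<in> hole" for z using holeR[OF that] R(1) by linarith
      then show "hole \<subseteq> BB" by (auto simp: hole_def BB_def)
      show "near k \<subseteq> BB" "mid k \<subseteq> BB" using rR1[of k] by (auto simp: near_def mid_def BB_def)
    qed
    have em: "emeasure lborel X = ennreal (measure lborel X)" if "X \<subseteq> BB" "X \<in> sets borel" for X
      using fin[OF that] by (intro emeasure_eq_ennreal_measure) auto

    \<comment> \<open>The double integral at scale \<open>r k\<close>, bounded below and above.\<close>
    have count: "(1 - \<tau>) * (U * r k ^ m) * R ^ m
        \<le> ((1 + 2 * \<tau>) * r k) ^ m * measure lborel (near k) + (3 * r k) ^ m * measure lborel (mid k)"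
      if k: "k < N" for k
    proof -
      let ?r = "r k"
      let ?BR = "{z. koranyi_dist x z \<le> R}"
      have [measurable]: "?BR \<in> sets borel" by measurable
      have sm: "sets \<mu> = sets borel" by (rule uniformD(1)[OF u])
      have "ennreal ((1 - \<tau>) * (U * ?r ^ m) * R ^ m)
          = ennreal ((1 - \<tau>) * (U * ?r ^ m)) * emeasure \<mu> ?BR"
      proof -
        have "emeasure \<mu> ?BR = ennreal (R ^ m)"
          unfolding m_def by (rule uniformD(4)[OF u]) (use x R(1) in \<open>auto simp: S_def\<close>)
        then show ?thesis using \<tau>1 U r0[of k] R(1) by (simp add: ennreal_mult[symmetric])
      qed
      also have "\<dots> = (\<integral>\<^sup>+x'. ennreal ((1 - \<tau>) * (U * ?r ^ m)) * indicator ?BR x' \<partial>\<mu>)"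
        by (rule nn_integral_cmult_indicator[symmetric]) (simp add: sm)
      also have "\<dots> \<le> (\<integral>\<^sup>+x'. indicator ?BR x' * emeasure lborel ({z. koranyi_dist x' z \<le> ?r} \<inter> A) \<partial>\<mu>)"
      proof (rule nn_integral_mono_AE)
        show "AE x' in \<mu>. ennreal ((1 - \<tau>) * (U * ?r ^ m)) * indicator ?BR x'
            \<le> indicator ?BR x' * emeasure lborel ({z. koranyi_dist x' z \<le> ?r} \<inter> A)"
          using AE_msupport[OF sm]
        proof eventually_elim
          fix x' assume x': "x' \<in> msupport \<mu>"
          show "ennreal ((1 - \<tau>) * (U * ?r ^ m)) * indicator ?BR x'
            \<le> indicator ?BR x' * emeasure lborel ({z. koranyi_dist x' z \<le> ?r} \<inter> A)"
          proof (cases "x' \<in> ?BR")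
            case True
            then have "koranyi_dist p x' < \<rho>"
              using koranyi_dist_triangle[of p x' x] px d\<rho> d by (simp add: R_def)
            moreover have "x' \<in> quadric b Q T" using x' sub by auto
            moreover have "?r \<le> \<rho>" using rR1[of k] R\<rho> R(1) by linarith
            ultimately show ?thesis using vol(1)[of x' ?r] rN[OF k] True by simp
          qed simp
        qed
      qed
      also have "\<dots> = (\<integral>\<^sup>+y'. indicator A y' * emeasure \<mu> ({z. koranyi_dist y' z \<le> ?r} \<inter> ?BR) \<partial>lborel)"
        by (rule fubini_koranyi_balls[OF sm sets_lborel uniformD(2)[OF u] lborel.sigma_finite_measure_axioms]) measurable
      also have "\<dots> \<le> (\<integral>\<^sup>+y'. ennreal (((1 + 2 * \<tau>) * ?r) ^ m) * indicator (near k) y'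
          + ennreal ((3 * ?r) ^ m) * indicator (mid k) y' \<partial>lborel)"
      proof (rule nn_integral_mono)
        fix y'
        let ?M = "emeasure \<mu> ({z. koranyi_dist y' z \<le> ?r} \<inter> ?BR)"
        have M: "?M \<le> emeasure \<mu> {z. koranyi_dist y' z \<le> ?r}"
          by (rule emeasure_mono) (auto simp: sm)
        consider "y' \<notin> A" | "?r < D y'" | "R + ?r < koranyi_dist x y'"
          | "y' \<in> near k" | "y' \<in> mid k"
          using rR1[of k] by (force simp: near_def mid_def)
        then show "indicator A y' * ?M \<le> ennreal (((1 + 2 * \<tau>) * ?r) ^ m) * indicator (near k) y'
          + ennreal ((3 * ?r) ^ m) * indicator (mid k) y'"
        proof cases
          case 2
          then have "?M = 0"
            using M uniform_ball_far[OF u, of ?r y'] by (simp add: D_def S_def)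
          then show ?thesis by simp
        next
          case 3
          have "{z. koranyi_dist y' z \<le> ?r} \<inter> ?BR = {}"
          proof safe
            fix z assume "koranyi_dist y' z \<le> ?r" "koranyi_dist x z \<le> R"
            then show "z \<in> {}" using 3 koranyi_dist_triangle[of x y' z] koranyi_dist_sym[of z y'] by simp
          qed
          then show ?thesis by simp
        next
          case 4
          have "0 < \<tau> * ?r" using \<tau> r0[of k] by simp
          then have "D y' < 2 * \<tau> * ?r" using 4 by (simp add: near_def)
          then have "emeasure \<mu> {z. koranyi_dist y' z \<le> ?r} \<le> ennreal ((?r + 2 * \<tau> * ?r) ^ m)"
            unfolding m_def by (intro uniform_ball_le[OF u _ r0]) (simp add: D_def S_def)
          also have "?r + 2 * \<tau> * ?r = (1 + 2 * \<tau>) * ?r" by (simp add: algebra_simps)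
          finally have "?M \<le> ennreal (((1 + 2 * \<tau>) * ?r) ^ m)" using M by order
          then show ?thesis using 4 by (simp add: near_def indicator_def add_increasing2)
        next
          case 5
          then have "D y' < 2 * ?r" using r0[of k] by (simp add: mid_def)
          then have "emeasure \<mu> {z. koranyi_dist y' z \<le> ?r} \<le> ennreal ((?r + 2 * ?r) ^ m)"
            unfolding m_def by (intro uniform_ball_le[OF u _ r0]) (simp add: D_def S_def)
          also have "?r + 2 * ?r = 3 * ?r" by simp
          finally have "?M \<le> ennreal ((3 * ?r) ^ m)" using M by order
          then show ?thesis using 5 by (simp add: mid_def indicator_def add_increasing)
        qed simp
      qed
      also have "\<dots> = ennreal (((1 + 2 * \<tau>) * ?r) ^ m) * emeasure lborel (near k)
          + ennreal ((3 * ?r) ^ m) * emeasure lborel (mid k)"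
        by (subst nn_integral_add) (simp_all add: nn_integral_cmult_indicator)
      also have "\<dots> = ennreal (((1 + 2 * \<tau>) * ?r) ^ m * measure lborel (near k)
          + (3 * ?r) ^ m * measure lborel (mid k))"
        using \<tau> r0[of k] by (simp add: em subs ennreal_mult ennreal_plus)
      finally show ?thesis
        using \<tau> r0[of k] by (subst (asm) ennreal_le_iff) auto
    qed

    \<comment> \<open>The hole about \<open>y\<close> and \<open>near k\<close> share the slab in a ball of radius \<open>R + r k\<close>.\<close>
    have near_le: "measure lborel (near k) \<le> U * R ^ m * ((1 + \<tau>) * (1 + \<tau>) ^ m - (1 - \<tau>) / 6 ^ m)"
      if k: "k < N" for k
    proof -
      have "near k \<inter> hole = {}"
      proof safe
        fix z assume z: "z \<in> near k" "z \<in> hole"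
        have "d \<le> koranyi_dist y z + D z"
          unfolding d_def D_def by (rule koranyi_setdist_triangle[OF neS])
        moreover have "\<tau> * r k \<le> 1 / 6 * (R / 6)"
          using \<tau> order_trans[OF rR[of k] \<tau>R] r0[of k] by (intro mult_mono) auto
        ultimately show "z \<in> {}" using z R(1) d by (simp add: near_def hole_def R_def)
      qed
      then have "measure lborel (near k) + measure lborel hole = measure lborel (near k \<union> hole)"
        using fin[OF subs(1)[of k]] fin[OF subs(3)]
        by (intro measure_Union[symmetric]) (simp_all add: less_top)
      also have "ennreal \<dots> = emeasure lborel (near k \<union> hole)"
        using em[of "near k \<union> hole"] subs by simp
      also have "\<dots> \<le> emeasure lborel ({z. koranyi_dist x z \<le> R + r k} \<inter> A)"
        using holeR r0[of k] by (intro emeasure_mono) (fastforce simp: near_def hole_def)+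
      also have "\<dots> \<le> ennreal ((1 + \<tau>) * (U * (R + r k) ^ m))"
        by (rule vol(2)[OF xK]; use px R\<rho> tNR R(1) \<rho> rR1[of k] r0[of k] in linarith)
      finally have "measure lborel (near k) + measure lborel hole \<le> (1 + \<tau>) * (U * (R + r k) ^ m)"
        using \<tau> U R(1) r0[of k] by (subst (asm) ennreal_le_iff) auto
      also have "\<dots> \<le> (1 + \<tau>) * (U * ((1 + \<tau>) * R) ^ m)"
        using \<tau> U R(1) r0[of k] rR[of k] by (intro mult_left_mono power_mono) (auto simp: algebra_simps)
      finally have 1: "measure lborel (near k) + measure lborel hole \<le> (1 + \<tau>) * (U * ((1 + \<tau>) * R) ^ m)" .
      have "ennreal ((1 - \<tau>) * (U * (R / 6) ^ m)) \<le> emeasure lborel hole"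
        unfolding hole_def R(2) by (rule vol(1)[OF y(1)]; use y(2) R\<rho> tNR R(1) \<rho> in linarith)
      then have "(1 - \<tau>) * (U * (R / 6) ^ m) \<le> measure lborel hole"
        using em[OF subs(3)] by simp
      moreover have "(1 + \<tau>) * (U * ((1 + \<tau>) * R) ^ m) = U * R ^ m * ((1 + \<tau>) * (1 + \<tau>) ^ m)"
        by (simp add: power_mult_distrib)
      moreover have "(1 - \<tau>) * (U * (R / 6) ^ m) = U * R ^ m * ((1 - \<tau>) / 6 ^ m)"
        by (simp add: power_divide)
      ultimately show ?thesis using 1 unfolding right_diff_distrib by linarith
    qed

    have "(\<Sum>k<N. measure lborel (mid k)) = measure lborel (\<Union>k<N. mid k)"
    proof (rule measure_finite_Union[symmetric])
      have "mid j \<inter> mid k = {}" if "j < k" for j k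
        using r\<tau>[OF that] by (auto simp: mid_def)
      then show "disjoint_family_on mid {..<N}"
        unfolding disjoint_family_on_def by (metis inf_commute linorder_neqE_nat)
      show "emeasure lborel (mid k) \<noteq> \<infinity>" if "k \<in> {..<N}" for k
        using fin[OF subs(2)[of k]] by (simp add: less_top)
    qed auto
    moreover have "ennreal (measure lborel (\<Union>k<N. mid k)) \<le> ennreal ((1 + \<tau>) * (U * (2 * R) ^ m))"
    proof -
      have s: "(\<Union>k<N. mid k) \<subseteq> BB" using subs by auto
      then have "ennreal (measure lborel (\<Union>k<N. mid k)) = emeasure lborel (\<Union>k<N. mid k)"
        by (intro em[symmetric]) auto
      also have "\<dots> \<le> emeasure lborel BB" using s by (intro emeasure_mono) auto
      finally show ?thesis using BB by order
    qed
    ultimately have "(\<Sum>k<N. measure lborel (mid k)) \<le> (1 + \<tau>) * (U * (2 * R) ^ m)"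
      using \<tau> U R(1) by (simp add: ennreal_le_iff)
    then obtain k where k: "k < N" "measure lborel (mid k) \<le> \<tau> * ((1 + \<tau>) * (U * (2 * R) ^ m))"
      using small_member_of_sum[OF _ N N1] \<tau> U R(1) by fastforce
    define P where "P = U * r k ^ m * R ^ m"
    have P: "P > 0" using U r0[of k] R(1) by (simp add: P_def)
    have "(1 - \<tau>) * P = (1 - \<tau>) * (U * r k ^ m) * R ^ m" by (simp add: P_def)
    also have "\<dots> \<le> ((1 + 2 * \<tau>) * r k) ^ m * measure lborel (near k) + (3 * r k) ^ m * measure lborel (mid k)"
      by (rule count[OF k(1)])
    also have "\<dots> \<le> ((1 + 2 * \<tau>) * r k) ^ m * (U * R ^ m * ((1 + \<tau>) * (1 + \<tau>) ^ m - (1 - \<tau>) / 6 ^ m))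
        + (3 * r k) ^ m * (\<tau> * ((1 + \<tau>) * (U * (2 * R) ^ m)))"
      using \<tau> r0[of k] by (intro add_mono mult_left_mono near_le k) auto
    also have "\<dots> = P * ((1 + 2 * \<tau>) ^ m * ((1 + \<tau>) * (1 + \<tau>) ^ m - (1 - \<tau>) / 6 ^ m)
        + 3 ^ m * (\<tau> * (1 + \<tau>) * 2 ^ m))"
      unfolding P_def power_mult_distrib distrib_left[of "U * r k ^ m * R ^ m"]
      by (simp only: mult_ac)
    also have "\<dots> < P * (1 - \<tau>)" using \<tau>m P by (rule mult_strict_left_mono)
    finally show False by simp
  qed
  then show ?thesis using \<rho> unfolding S_def by (intro exI[of _ "\<rho> / 8"]) auto
qed

section \<open>The support is not carried by characteristic points\<close>

text \<open>
  Integrate \<open>d(x, y) \<le> r\<close> over \<open>x\<close> in the ball of radius \<open>\<rho>\<close> about \<open>p\<close> and all \<open>y\<close>: each \<open>x\<close> sees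
  the volume of a ball of radius \<open>r\<close>, and each \<open>y\<close> sees at most the \<open>\<mu>\<close>-measure of a ball of radius
  \<open>3 r\<close> centred on the support, and none unless it lies in \<open>E\<close>.
\<close>

lemma emeasure_thickening_ge:
  fixes \<mu> :: "'n::finite heis measure"
  assumes u: "codim1_uniform \<mu>" and p: "p \<in> msupport \<mu>" and r: "0 < r" "r \<le> \<rho>"
    and E [measurable]: "E \<in> sets borel"
    and near: "\<And>x y. x \<in> msupport \<mu> \<Longrightarrow> koranyi_dist p x \<le> \<rho> \<Longrightarrow> koranyi_dist x y \<le> r \<Longrightarrow> y \<in> E"
  shows "ennreal (r * \<rho> ^ (2 * CARD('n) + 1)) * emeasure lborel (koranyi_ball (0::'n heis) 1)
    \<le> ennreal (3 ^ (2 * CARD('n) + 1)) * emeasure lborel E"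
proof -
  define m where "m = 2 * CARD('n) + 1"
  let ?B = "{x. koranyi_dist p x \<le> \<rho>}"
  have [measurable]: "?B \<in> sets borel" by measurable
  have sm: "sets \<mu> = sets borel" by (rule uniformD(1)[OF u])
  define \<beta> where "\<beta> = emeasure lborel (koranyi_ball (0::'n heis) 1)"
  have vol: "emeasure lborel {z. koranyi_dist x z \<le> r} = ennreal (r ^ Suc m) * \<beta>" for x :: "'n heis"
  proof -
    have "{u. heis_mult x (heis_dil r u) \<in> {z. koranyi_dist x z \<le> r}} = koranyi_ball 0 1"
      using r by (auto simp: koranyi_dist_mult koranyi_norm_dil mem_koranyi_ball)
    moreover have "{z. koranyi_dist x z \<le> r} \<in> sets borel" by measurable
    ultimately show ?thesis
      using emeasure_heis[of "{z. koranyi_dist x z \<le> r}" r x] r by (simp add: m_def \<beta>_def)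
  qed
  have "ennreal (r ^ Suc m) * \<beta> * ennreal (\<rho> ^ m) = ennreal (r ^ Suc m) * \<beta> * emeasure \<mu> ?B"
    using uniformD(4)[OF u p, of \<rho>] r by (simp add: m_def)
  also have "\<dots> = (\<integral>\<^sup>+x. indicator ?B x * emeasure lborel ({z. koranyi_dist x z \<le> r} \<inter> UNIV) \<partial>\<mu>)"
  proof -
    have "(\<integral>\<^sup>+x. indicator ?B x * emeasure lborel ({z. koranyi_dist x z \<le> r} \<inter> UNIV) \<partial>\<mu>)
        = (\<integral>\<^sup>+x. (ennreal (r ^ Suc m) * \<beta>) * indicator ?B x \<partial>\<mu>)"
      by (rule nn_integral_cong) (simp only: Int_UNIV_right vol mult.commute)
    also have "\<dots> = ennreal (r ^ Suc m) * \<beta> * emeasure \<mu> ?B"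
      by (rule nn_integral_cmult_indicator) (simp add: sm)
    finally show ?thesis by simp
  qed
  also have "\<dots> = (\<integral>\<^sup>+y. indicator UNIV y * emeasure \<mu> ({z. koranyi_dist y z \<le> r} \<inter> ?B) \<partial>lborel)"
    by (rule fubini_koranyi_balls[OF sm sets_lborel uniformD(2)[OF u] lborel.sigma_finite_measure_axioms]) measurable
  also have "\<dots> \<le> (\<integral>\<^sup>+y. ennreal ((3 * r) ^ m) * indicator E y \<partial>lborel)"
  proof (rule nn_integral_mono)
    fix y
    show "indicator UNIV y * emeasure \<mu> ({z. koranyi_dist y z \<le> r} \<inter> ?B) \<le> ennreal ((3 * r) ^ m) * indicator E y"
    proof (cases "y \<in> E")
      case False
      have "AE x in \<mu>. x \<notin> {z. koranyi_dist y z \<le> r} \<inter> ?B"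
        using AE_msupport[OF sm]
      proof eventually_elim
        fix x assume "x \<in> msupport \<mu>"
        from near[OF this, of y] show "x \<notin> {z. koranyi_dist y z \<le> r} \<inter> ?B"
          using False koranyi_dist_sym[of x y] by auto
      qed
      moreover have "{z. koranyi_dist y z \<le> r} \<inter> ?B \<in> sets \<mu>" unfolding sm by measurable
      ultimately have "{z. koranyi_dist y z \<le> r} \<inter> ?B \<in> null_sets \<mu>" by (simp only: AE_iff_null_sets)
      then have "emeasure \<mu> ({z. koranyi_dist y z \<le> r} \<inter> ?B) = 0" by (rule null_setsD1)
      then show ?thesis by simp
    next
      case True
      have "emeasure \<mu> ({z. koranyi_dist y z \<le> r} \<inter> ?B) \<le> emeasure \<mu> {z. koranyi_dist y z \<le> r}"
        by (rule emeasure_mono) (auto simp: sm)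
      also have "\<dots> \<le> ennreal ((3 * r) ^ m)"
      proof (cases "r < koranyi_setdist (msupport \<mu>) y")
        case True
        then show ?thesis using uniform_ball_far[OF u True] by simp
      next
        case False
        then have "emeasure \<mu> {z. koranyi_dist y z \<le> r} \<le> ennreal ((r + 2 * r) ^ m)"
          unfolding m_def using r by (intro uniform_ball_le[OF u]) auto
        then show ?thesis by simp
      qed
      finally show ?thesis using True by simp
    qed
  qed
  also have "\<dots> = ennreal ((3 * r) ^ m) * emeasure lborel E"
    by (rule nn_integral_cmult_indicator) simp
  finally have "ennreal (r ^ m) * (ennreal (r * \<rho> ^ m) * \<beta>) \<le> ennreal (r ^ m) * (ennreal (3 ^ m) * emeasure lborel E)"
    using r by (simp add: power_mult_distrib ennreal_mult mult_ac)
  then have "ennreal (r * \<rho> ^ m) * \<beta> \<le> ennreal (3 ^ m) * emeasure lborel E"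
    using r by (subst (asm) ennreal_mult_le_mult_iff) auto
  then show ?thesis by (simp add: m_def \<beta>_def)
qed

lemma koranyi_ball_volume_pos: "emeasure lborel (koranyi_ball (0::'n::finite heis) 1) > 0"
proof -
  obtain e where e: "e > 0" "ball (0::'n heis) e \<subseteq> {x. koranyi_dist 0 x < 1}"
    using open_koranyi[of "0::'n heis" 1] by (metis (no_types, lifting) koranyi_dist_self mem_Collect_eq
        open_contains_ball zero_less_one)
  then have "ball (0::'n heis) e \<subseteq> koranyi_ball 0 1" by (force simp: mem_koranyi_ball)
  then have "emeasure lborel (ball (0::'n heis) e) \<le> emeasure lborel (koranyi_ball (0::'n heis) 1)"
    by (rule emeasure_mono) (simp add: borel_closed closed_koranyi_ball)
  moreover have "emeasure lborel (ball (0::'n heis) e) > 0"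
    using e by (simp add: emeasure_ball unit_ball_vol_pos)
  ultimately show ?thesis by order
qed

lemma uniform_support_not_thin:
  fixes \<mu> :: "'n::finite heis measure"
  assumes u: "codim1_uniform \<mu>" and p: "p \<in> msupport \<mu>" and \<rho>: "\<rho> > 0"
    and C: "C \<ge> 0" and M: "M < \<infinity>"
    and thin: "\<And>r. 0 < r \<Longrightarrow> r \<le> \<rho> \<Longrightarrow> \<exists>E\<in>sets borel. emeasure lborel E \<le> ennreal (C * r\<^sup>2) * M \<and>
      (\<forall>x y. x \<in> msupport \<mu> \<longrightarrow> koranyi_dist p x \<le> \<rho> \<longrightarrow> koranyi_dist x y \<le> r \<longrightarrow> y \<in> E)"
  shows False
proof -
  define m where "m = 2 * CARD('n) + 1"
  define \<beta> where "\<beta> = emeasure lborel (koranyi_ball (0::'n heis) 1)"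
  have "\<beta> < \<infinity>"
    unfolding \<beta>_def using emeasure_bounded_finite[OF compact_imp_bounded[OF compact_koranyi_ball]] .
  then have \<beta>: "\<beta> = ennreal (enn2real \<beta>)" "enn2real \<beta> > 0"
    using koranyi_ball_volume_pos by (simp_all add: \<beta>_def enn2real_positive_iff less_top)
  have M': "M = ennreal (enn2real M)" using M by (simp add: less_top)
  define A where "A = \<rho> ^ m * enn2real \<beta>"
  define B where "B = 3 ^ m * (C * enn2real M)"
  have A: "A > 0" using \<rho> \<beta> by (simp add: A_def)
  have B: "B \<ge> 0" using C by (simp add: B_def)
  have le: "A \<le> B * r" if r: "0 < r" "r \<le> \<rho>" for r
  proof -
    obtain E where E: "E \<in> sets borel" "emeasure lborel E \<le> ennreal (C * r\<^sup>2) * M"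
      "\<And>x y. x \<in> msupport \<mu> \<Longrightarrow> koranyi_dist p x \<le> \<rho> \<Longrightarrow> koranyi_dist x y \<le> r \<Longrightarrow> y \<in> E"
      using thin[OF r] by blast
    have "ennreal (r * \<rho> ^ m) * \<beta> \<le> ennreal (3 ^ m) * emeasure lborel E"
      unfolding m_def \<beta>_def by (rule emeasure_thickening_ge[OF u p r E(1) E(3)])
    also have "\<dots> \<le> ennreal (3 ^ m) * (ennreal (C * r\<^sup>2) * M)"
      by (intro mult_left_mono E(2) zero_le)
    finally have "ennreal (r * A) \<le> ennreal (r * (B * r))"
      using r C \<rho> by (subst (asm) \<beta>(1), subst (asm) M')
        (simp add: ennreal_mult[symmetric] A_def B_def power2_eq_square mult_ac)
    then have "r * A \<le> r * (B * r)" using r B by (subst (asm) ennreal_le_iff) auto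
    then show ?thesis using r by simp
  qed
  define r where "r = min \<rho> (A / (2 * (B + 1)))"
  have r: "0 < r" "r \<le> \<rho>" using A B \<rho> by (auto simp: r_def)
  have "B * r \<le> (B + 1) * (A / (2 * (B + 1)))"
    using A B \<rho> by (intro mult_mono) (auto simp: r_def)
  also have "\<dots> = A / 2"
  proof -
    have "2 * B + 2 \<noteq> 0" using B by linarith
    then show ?thesis by (simp add: field_simps)
  qed
  finally show False using le[OF r] A by simp
qed

text \<open>
  The set \<open>F\<close> contains every line in the direction \<open>e\<close> that meets \<open>E\<close>.  If \<open>F\<close> is thin in another
  direction, the lemma applies again, to the intersection on the right.
\<close>

lemma emeasure_slab_cball_le:
  fixes l :: "'a::euclidean_space \<Rightarrow> real"
  assumes l: "bounded_linear l" and e: "l e = 1" and E: "E \<in> sets borel" and F: "F \<in> sets borel"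
    and K: "\<And>w. \<bar>l w\<bar> \<le> K * norm w" "K \<ge> 0"
    and R: "E \<subseteq> cball 0 R"
    and D: "\<And>w s s'. w + s *\<^sub>R e \<in> E \<Longrightarrow> w + s' *\<^sub>R e \<in> E \<Longrightarrow> \<bar>s - s'\<bar> \<le> D"
    and EF: "\<And>w s. w + s *\<^sub>R e \<in> E \<Longrightarrow> w \<in> F"
  shows "emeasure lborel E \<le> ennreal D * emeasure lborel (F \<inter> cball 0 (R + (K * R + 1) * norm e))"
proof (rule emeasure_slices_le[OF l e E])
  interpret l: bounded_linear l by fact
  show "F \<inter> cball 0 (R + (K * R + 1) * norm e) \<in> sets borel" using F by measurable
  fix w s assume w: "0 \<le> l w" "l w < 1" "w + s *\<^sub>R e \<in> E"
  have n: "norm (w + s *\<^sub>R e) \<le> R" using w R by auto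
  have "\<bar>l (w + s *\<^sub>R e)\<bar> \<le> K * R" by (rule order_trans[OF K(1)]) (use n K in \<open>intro mult_left_mono\<close>)
  then have "\<bar>s\<bar> \<le> K * R + 1" using w by (simp add: l.add l.scaleR e)
  then have "\<bar>s\<bar> * norm e \<le> (K * R + 1) * norm e" by (intro mult_right_mono) auto
  moreover have "norm w \<le> norm (w + s *\<^sub>R e) + \<bar>s\<bar> * norm e"
    using norm_triangle_ineq4[of "w + s *\<^sub>R e" "s *\<^sub>R e"] by simp
  ultimately show "w \<in> F \<inter> cball 0 (R + (K * R + 1) * norm e)"
    using n EF[OF w(3)] by simp
qed (use D in auto)

text \<open>
  If the range of the symmetric matrix were a line, the quadratic form would be a multiple of the
  square of a linear form, and its zero set a hyperplane.
\<close>

lemma two_orthogonal_images: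
  fixes Q :: "real^'a::finite^'a"
  assumes Q: "transpose Q = Q" and a: "Q *v a \<noteq> 0"
    and not_square: "\<not> (\<exists>v. v \<noteq> 0 \<and> (\<forall>h. h \<bullet> (Q *v h) = 0 \<longleftrightarrow> v \<bullet> h = 0))"
  shows "\<exists>a1 a2. Q *v a1 \<noteq> 0 \<and> Q *v a2 \<noteq> 0 \<and> (Q *v a1) \<bullet> (Q *v a2) = 0"
proof -
  define w where "w = Q *v a"
  have w: "w \<noteq> 0" using a by (simp add: w_def)
  define \<phi> where "\<phi> h = (w \<bullet> (Q *v h)) / (w \<bullet> w)" for h
  have sym: "a \<bullet> (Q *v h) = w \<bullet> h" for h using symmetric_inner[OF Q] by (simp add: w_def)
  show ?thesis
  proof (cases "\<forall>h. Q *v h = \<phi> h *\<^sub>R w")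
    case True
    have \<phi>: "\<phi> h * (a \<bullet> w) = w \<bullet> h" for h
      using sym[of h] True by (metis inner_scaleR_right)
    have aw: "a \<bullet> w \<noteq> 0" using \<phi>[of w] w by auto
    have "h \<bullet> (Q *v h) = (w \<bullet> h)\<^sup>2 / (a \<bullet> w)" for h
    proof -
      have "h \<bullet> (Q *v h) = \<phi> h * (h \<bullet> w)" using True by (metis inner_scaleR_right)
      also have "\<phi> h = (w \<bullet> h) / (a \<bullet> w)" using \<phi>[of h] aw by (simp add: field_simps)
      finally show ?thesis by (simp add: power2_eq_square inner_commute)
    qed
    then have "\<forall>h. h \<bullet> (Q *v h) = 0 \<longleftrightarrow> w \<bullet> h = 0" using aw by simp
    then show ?thesis using not_square w by blast
  next
    case False
    then obtain h where h: "Q *v h \<noteq> \<phi> h *\<^sub>R w" by blast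
    have "Q *v (h - \<phi> h *\<^sub>R a) = Q *v h - \<phi> h *\<^sub>R w"
      by (simp only: mat_diff mat_scaleR w_def)
    moreover have "w \<bullet> (Q *v h - \<phi> h *\<^sub>R w) = 0"
      using w by (simp add: inner_diff_right \<phi>_def)
    ultimately show ?thesis
      using h a by (intro exI[of _ a] exI[of _ "h - \<phi> h *\<^sub>R a"]) (simp add: w_def)
  qed
qed

text \<open>
  By homogeneity of degree two under the dilations.
\<close>

lemma quadric_fun_0_bound: "\<exists>C\<ge>0. \<forall>r v. 0 < r \<longrightarrow> koranyi_norm v \<le> r \<longrightarrow> \<bar>quadric_fun 0 Q T v\<bar> \<le> C * r\<^sup>2"
proof -
  obtain C where C: "C > 0" "\<And>y. koranyi_norm y \<le> 1 \<Longrightarrow> \<bar>quadric_fun 0 Q T y\<bar> \<le> C"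
    using quadric_fun_bounded[of 1 0 Q T] by blast
  have "\<bar>quadric_fun 0 Q T v\<bar> \<le> C * r\<^sup>2" if r: "0 < r" and v: "koranyi_norm v \<le> r" for r v
  proof -
    define u where "u = heis_dil (1 / r) v"
    have "v = heis_dil r u" using r by (simp add: u_def)
    then have "\<bar>quadric_fun 0 Q T v\<bar> = r\<^sup>2 * \<bar>quadric_fun 0 Q T u\<bar>"
      by (simp add: quadric_fun_0_dil abs_mult)
    also have "koranyi_norm u \<le> 1" using r v by (simp add: u_def koranyi_norm_dil)
    then have "r\<^sup>2 * \<bar>quadric_fun 0 Q T u\<bar> \<le> r\<^sup>2 * C" by (intro mult_left_mono C(2)) auto
    finally show ?thesis by (simp add: mult.commute)
  qed
  then show ?thesis using C(1) by (intro exI[of _ C]) auto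
qed

text \<open>
  A point at distance at most \<open>r\<close> from a characteristic point of the quadric satisfies
  \<open>\<bar>f\<bar> \<le> C r\<^sup>2\<close>, because the first-order term of the expansion is absent.  If \<open>T \<noteq> 0\<close>, this confines it to
  a vertical layer of height of order \<open>r\<^sup>2\<close>.  If \<open>T = 0\<close>, the characteristic points \<open>x\<close> have all the
  same \<open>Q x\<^sub>H\<close>, and two independent vectors in the range of \<open>Q\<close> confine the neighbourhood in two
  horizontal directions to widths of order \<open>r\<close>.  In both cases the volume is of order \<open>r\<^sup>2\<close>.
\<close>

lemma support_not_characteristic:
  fixes \<mu> :: "'n::finite heis measure"
  assumes u: "codim1_uniform \<mu>" and Q: "transpose Q = Q"
    and sub: "msupport \<mu> \<subseteq> quadric b Q T" and p: "p \<in> msupport \<mu>" and \<rho>: "\<rho> > 0"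
    and nondeg: "T \<noteq> 0 \<or> (\<exists>a. Q *v a \<noteq> 0) \<and> \<not> (\<exists>v. v \<noteq> 0 \<and> (\<forall>h. h \<bullet> (Q *v h) = 0 \<longleftrightarrow> v \<bullet> h = 0))"
  shows "\<exists>x\<in>msupport \<mu>. koranyi_dist p x \<le> \<rho> \<and> quadric_hgrad b Q T x \<noteq> 0"
proof (rule ccontr)
  assume "\<not> ?thesis"
  then have char: "quadric_hgrad b Q T x = 0" if "x \<in> msupport \<mu>" "koranyi_dist p x \<le> \<rho>" for x
    using that by blast
  obtain R where R: "koranyi_ball p (2 * \<rho>) \<subseteq> cball 0 R" "R > 0"
    using compact_imp_bounded[OF compact_koranyi_ball[of p "2 * \<rho>"]] by (metis bounded_pos mem_cball_0 subsetI)
  have inR: "y \<in> cball 0 R" if "koranyi_dist p x \<le> \<rho>" "koranyi_dist x y \<le> r" "r \<le> \<rho>" for x y r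
  proof -
    have "koranyi_dist p y \<le> 2 * \<rho>" using that koranyi_dist_triangle[of p y x] by linarith
    then show ?thesis using R(1) by (auto simp only: mem_koranyi_ball[symmetric])
  qed
  have finite: "emeasure lborel (UNIV \<inter> cball (0::'n heis) t) < \<infinity>" for t
    using emeasure_lborel_cball_finite by simp
  show False
  proof (cases "T = 0")
    case False
    obtain C where C: "C \<ge> 0" "\<And>r v. 0 < r \<Longrightarrow> koranyi_norm v \<le> r \<Longrightarrow> \<bar>quadric_fun 0 Q T v\<bar> \<le> C * r\<^sup>2"
      using quadric_fun_0_bound[of Q T] by blast
    define e :: "'n heis" where "e = (0, 1 / T)"
    define l :: "'n heis \<Rightarrow> real" where "l w = T * snd w" for w
    have l: "bounded_linear l"
      unfolding l_def by (intro bounded_linear_intros)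
    have shift: "quadric_fun b Q T (w + s *\<^sub>R e) = quadric_fun b Q T w + s" for w s
      using False by (simp add: quadric_fun_def e_def algebra_simps)
    show False
    proof (rule uniform_support_not_thin[OF u p \<rho> _ finite])
      fix r assume r: "0 < r" "r \<le> \<rho>"
      define E where "E = cball 0 R \<inter> {y. \<bar>quadric_fun b Q T y\<bar> \<le> C * r\<^sup>2}"
      have Em: "E \<in> sets borel" unfolding E_def by measurable
      show "\<exists>E\<in>sets borel. emeasure lborel E \<le> ennreal (2 * C * r\<^sup>2)
            * emeasure lborel (UNIV \<inter> cball (0::'n heis) (R + (\<bar>T\<bar> * R + 1) * norm e)) \<and>
          (\<forall>x y. x \<in> msupport \<mu> \<longrightarrow> koranyi_dist p x \<le> \<rho> \<longrightarrow> koranyi_dist x y \<le> r \<longrightarrow> y \<in> E)"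
      proof (intro bexI[OF _ Em] conjI allI impI)
        show "emeasure lborel E \<le> ennreal (2 * C * r\<^sup>2)
            * emeasure lborel (UNIV \<inter> cball (0::'n heis) (R + (\<bar>T\<bar> * R + 1) * norm e))"
        proof (rule emeasure_slab_cball_le[OF l _ Em])
          show "l e = 1" using False by (simp add: l_def e_def)
          show "\<bar>l w\<bar> \<le> \<bar>T\<bar> * norm w" for w
            using norm_snd_le[of "snd w" "fst w"] by (simp add: l_def abs_mult mult_left_mono)
          show "\<bar>s - s'\<bar> \<le> 2 * C * r\<^sup>2" if "w + s *\<^sub>R e \<in> E" "w + s' *\<^sub>R e \<in> E" for w s s'
            using that unfolding E_def by (simp add: shift abs_le_iff)
        qed (auto simp: E_def)
        fix x y assume x: "x \<in> msupport \<mu>" "koranyi_dist p x \<le> \<rho>" and xy: "koranyi_dist x y \<le> r"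
        define v where "v = heis_mult (heis_inv x) y"
        have "y = heis_mult x v" by (simp add: v_def)
        moreover have "quadric_fun b Q T x = 0" using x sub by (auto simp: mem_quadric)
        ultimately have "quadric_fun b Q T y = quadric_fun 0 Q T v"
          using char[OF x] by (simp add: quadric_fun_mult[OF Q])
        moreover have "\<bar>quadric_fun 0 Q T v\<bar> \<le> C * r\<^sup>2"
          by (rule C(2)[OF r(1)]) (use xy in \<open>simp add: v_def koranyi_dist_def\<close>)
        ultimately show "y \<in> E" unfolding E_def using inR[OF x(2) xy r(2)] by simp
      qed
    qed (use C in simp)
  next
    case True
    obtain a1 a2 where a: "Q *v a1 \<noteq> 0" "Q *v a2 \<noteq> 0" "(Q *v a1) \<bullet> (Q *v a2) = 0"
      using two_orthogonal_images[OF Q] nondeg True by blast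
    define w1 where "w1 = Q *v a1"
    define w2 where "w2 = Q *v a2"
    have w: "w1 \<noteq> 0" "w2 \<noteq> 0" "w2 \<bullet> w1 = 0" using a by (simp_all add: w1_def w2_def inner_commute)
    define W where "W = norm w1 + norm w2"
    have W: "norm w1 \<le> W" "norm w2 \<le> W" "W \<ge> 0" by (simp_all add: W_def)
    define R1 where "R1 = R + (norm w1 * R + 1) * norm (transversal w1)"
    define R2 where "R2 = R1 + (norm w2 * R1 + 1) * norm (transversal w2)"
    have K: "\<bar>c \<bullet> fst z\<bar> \<le> norm c * norm z" for c and z :: "'n heis"
      using Cauchy_Schwarz_ineq2[of c "fst z"] mult_left_mono[OF norm_fst_le[of "fst z" "snd z"], of "norm c"] by simp
    have pw: "w1 \<bullet> (fst x - fst p) = 0" "w2 \<bullet> (fst x - fst p) = 0"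
      if x: "x \<in> msupport \<mu>" "koranyi_dist p x \<le> \<rho>" for x
    proof -
      have "quadric_hgrad b Q T x - quadric_hgrad b Q T p = 0"
        using char[OF x] char[OF p] \<rho> by simp
      then have "2 *\<^sub>R (Q *v fst x) - 2 *\<^sub>R (Q *v fst p) = 0"
        unfolding quadric_hgrad_def using True by simp
      then have "Q *v (fst x - fst p) = 0"
        unfolding mat_diff by simp
      then show "w1 \<bullet> (fst x - fst p) = 0" "w2 \<bullet> (fst x - fst p) = 0"
        using symmetric_inner[OF Q, of a1 "fst x - fst p"] symmetric_inner[OF Q, of a2 "fst x - fst p"]
        by (simp_all add: w1_def w2_def)
    qed
    show False
    proof (rule uniform_support_not_thin[OF u p \<rho> _ finite])
      fix r assume r: "0 < r" "r \<le> \<rho>"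
      define F where "F = {y::'n heis. \<bar>w2 \<bullet> (fst y - fst p)\<bar> \<le> W * r}"
      define E where "E = cball 0 R \<inter> {y. \<bar>w1 \<bullet> (fst y - fst p)\<bar> \<le> W * r} \<inter> F"
      have Fm [measurable]: "F \<in> sets borel"
        unfolding F_def by (intro borel_closed closed_Collect_le continuous_intros)
      have "{y::'n heis. \<bar>w1 \<bullet> (fst y - fst p)\<bar> \<le> W * r} \<in> sets borel"
        by (intro borel_closed closed_Collect_le continuous_intros)
      then have Em: "E \<in> sets borel" unfolding E_def using Fm by auto
      show "\<exists>E\<in>sets borel. emeasure lborel E \<le> ennreal ((2 * W)\<^sup>2 * r\<^sup>2) * emeasure lborel (UNIV \<inter> cball (0::'n heis) R2) \<and>
          (\<forall>x y. x \<in> msupport \<mu> \<longrightarrow> koranyi_dist p x \<le> \<rho> \<longrightarrow> koranyi_dist x y \<le> r \<longrightarrow> y \<in> E)"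
      proof (intro bexI[OF _ Em] conjI allI impI)
        have "emeasure lborel E \<le> ennreal (2 * (W * r)) * emeasure lborel (F \<inter> cball 0 R1)"
          unfolding R1_def
        proof (rule emeasure_slab_cball_le[OF bounded_linear_inner_fst inner_transversal[OF w(1)] Em Fm K])
          show "\<bar>s - s'\<bar> \<le> 2 * (W * r)"
            if "z + s *\<^sub>R transversal w1 \<in> E" "z + s' *\<^sub>R transversal w1 \<in> E" for z s s'
            using that inner_transversal[OF w(1)] unfolding E_def
            by (simp add: inner_simps abs_le_iff)
          show "z \<in> F" if "z + s *\<^sub>R transversal w1 \<in> E" for z s
          proof -
            have "w2 \<bullet> fst (transversal w1) = 0" using w(3) by (simp add: transversal_def)
            then show ?thesis using that unfolding E_def F_def by (simp add: inner_simps)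
          qed
        qed (auto simp: E_def)
        also have "emeasure lborel (F \<inter> cball 0 R1) \<le> ennreal (2 * (W * r)) * emeasure lborel (UNIV \<inter> cball (0::'n heis) R2)"
          unfolding R2_def
        proof (rule emeasure_slab_cball_le[OF bounded_linear_inner_fst inner_transversal[OF w(2)] _ _ K])
          show "\<bar>s - s'\<bar> \<le> 2 * (W * r)"
            if "z + s *\<^sub>R transversal w2 \<in> F \<inter> cball 0 R1" "z + s' *\<^sub>R transversal w2 \<in> F \<inter> cball 0 R1" for z s s'
            using that inner_transversal[OF w(2)] unfolding F_def
            by (simp add: inner_simps abs_le_iff)
        qed (use Fm in auto)
        finally have "emeasure lborel E
            \<le> ennreal (2 * (W * r)) * (ennreal (2 * (W * r)) * emeasure lborel (UNIV \<inter> cball (0::'n heis) R2))"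
          by (simp add: mult_left_mono)
        also have "\<dots> = ennreal ((2 * W)\<^sup>2 * r\<^sup>2) * emeasure lborel (UNIV \<inter> cball (0::'n heis) R2)"
        proof -
          have "(2 * W)\<^sup>2 * r\<^sup>2 = (2 * (W * r)) * (2 * (W * r))" by (simp add: power2_eq_square)
          moreover have "0 \<le> 2 * (W * r)" using W(3) r by simp
          ultimately have "ennreal ((2 * W)\<^sup>2 * r\<^sup>2) = ennreal (2 * (W * r)) * ennreal (2 * (W * r))"
            by (simp only: ennreal_mult)
          then show ?thesis by (simp only: mult.assoc)
        qed
        finally show "emeasure lborel E \<le> ennreal ((2 * W)\<^sup>2 * r\<^sup>2) * emeasure lborel (UNIV \<inter> cball (0::'n heis) R2)" .
        fix x y assume x: "x \<in> msupport \<mu>" "koranyi_dist p x \<le> \<rho>" and xy: "koranyi_dist x y \<le> r"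
        define v where "v = fst (heis_mult (heis_inv x) y)"
        have v: "norm v \<le> r" using norm_fst_le_koranyi[of "heis_mult (heis_inv x) y"] xy
          unfolding v_def koranyi_dist_def by linarith
        have yv: "fst y - fst p = (fst x - fst p) + v" by (simp add: v_def heis_mult_def heis_inv_def)
        have "\<bar>c \<bullet> v\<bar> \<le> W * r" if "norm c \<le> W" for c
          by (rule order_trans[OF Cauchy_Schwarz_ineq2], rule mult_mono[OF that v]) (use W in auto)
        then show "y \<in> E"
          unfolding E_def F_def using inR[OF x(2) xy r(2)] pw[OF x] W
          by (simp only: IntI mem_Collect_eq yv inner_add_right add_0)
      qed
    qed simp
  qed
qed

section \<open>The support as a union of components\<close>

text \<open>
  The regular points of the support are relatively closed in the set of regular points of the quadric because
  the support is closed, and relatively open by \<open>support_contains_neighbourhood\<close>; so a component of that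
  set which meets the support is contained in it.
\<close>

lemma support_union_of_components:
  fixes \<mu> :: "'n::finite heis measure"
  assumes u: "codim1_uniform \<mu>" and Q: "transpose Q = Q"
    and sub: "msupport \<mu> \<subseteq> quadric b Q T"
    and sing: "singular_points (quadric b Q T) = {z \<in> quadric b Q T. quadric_hgrad b Q T z = 0}"
    and dense: "\<And>p \<rho>. p \<in> msupport \<mu> \<Longrightarrow> \<rho> > 0 \<Longrightarrow>
      \<exists>x\<in>msupport \<mu>. koranyi_dist p x \<le> \<rho> \<and> quadric_hgrad b Q T x \<noteq> 0"
  shows "\<exists>\<C> \<subseteq> components (quadric b Q T - singular_points (quadric b Q T)).
           msupport \<mu> = closure (\<Union>\<C>)"
proof -
  define X where "X = quadric b Q T - singular_points (quadric b Q T)"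
  define S where "S = msupport \<mu>"
  define P where "P = S - singular_points (quadric b Q T)"
  have X: "X = {z \<in> quadric b Q T. quadric_hgrad b Q T z \<noteq> 0}" by (auto simp: X_def sing)
  have P: "P = {z \<in> S. quadric_hgrad b Q T z \<noteq> 0}" using sub by (auto simp: P_def sing S_def)
  have PX: "P \<subseteq> X" using sub by (auto simp: P X S_def)
  define \<C> where "\<C> = {C \<in> components X. C \<inter> P \<noteq> {}}"
  have CP: "C \<subseteq> P" if C: "C \<in> components X" "C \<inter> P \<noteq> {}" for C
  proof -
    have CX: "C \<subseteq> X" and conn: "connected C"
      using C(1) in_components_subset in_components_connected by auto
    have "C \<inter> P = C \<inter> S" using CX by (auto simp: P X)
    then have "closedin (top_of_set C) (C \<inter> P)"
      by (simp add: S_def closed_msupport closedin_closed_Int)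
    moreover have "openin (top_of_set C) (C \<inter> P)"
    proof (subst openin_subopen, intro ballI)
      fix p assume p: "p \<in> C \<inter> P"
      then obtain \<rho> where \<rho>: "\<rho> > 0" "\<And>y. y \<in> quadric b Q T \<Longrightarrow> koranyi_dist p y < \<rho> \<Longrightarrow> y \<in> S"
        using support_contains_neighbourhood[OF u Q sub, of p] by (auto simp: P S_def)
      show "\<exists>V. openin (top_of_set C) V \<and> p \<in> V \<and> V \<subseteq> C \<inter> P"
        using p \<rho> CX
        by (intro exI[of _ "C \<inter> {y. koranyi_dist p y < \<rho>}"])
           (auto simp: P X intro: openin_open_Int open_koranyi)
    qed
    ultimately have "C \<inter> P = C" using conn C(2) unfolding connected_clopen by blast
    then show ?thesis by blast
  qed
  have "\<Union>\<C> = P"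
  proof
    show "\<Union>\<C> \<subseteq> P" using CP by (auto simp: \<C>_def)
    show "P \<subseteq> \<Union>\<C>"
    proof
      fix x assume "x \<in> P"
      moreover then obtain C where "C \<in> components X" "x \<in> C"
        using PX Union_components[of X] by blast
      ultimately show "x \<in> \<Union>\<C>" by (auto simp: \<C>_def)
    qed
  qed
  moreover have "closure P = S"
  proof
    show "closure P \<subseteq> S"
      by (rule closure_minimal) (auto simp: P S_def closed_msupport)
    show "S \<subseteq> closure P"
    proof
      fix p assume p: "p \<in> S"
      show "p \<in> closure P"
      proof (rule ccontr)
        assume "p \<notin> closure P"
        then obtain \<epsilon> where \<epsilon>: "\<epsilon> > 0" "\<forall>x. koranyi_dist p x < \<epsilon> \<longrightarrow> x \<in> - closure P"
          using koranyi_ball_open_nbhd[of "- closure P" p] by auto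
        obtain x where "x \<in> S" "koranyi_dist p x \<le> \<epsilon> / 2" "quadric_hgrad b Q T x \<noteq> 0"
          using dense[of p "\<epsilon> / 2"] p \<epsilon> by (auto simp: S_def)
        then have "x \<in> closure P" "koranyi_dist p x < \<epsilon>"
          using closure_subset[of P] \<epsilon> by (auto simp: P)
        then show False using \<epsilon> by blast
      qed
    qed
  qed
  moreover have "\<C> \<subseteq> components X" by (auto simp: \<C>_def)
  ultimately show ?thesis unfolding X_def[symmetric] S_def[symmetric] by blast
qed

theorem theorem1p5:
  fixes \<mu> :: "'n::finite heis measure"
    and b :: "'n horiz"
    and Q :: "real ^ ('n + 'n) ^ ('n + 'n)"
    and T :: real
  assumes "codim1_uniform \<mu>"
    and "transpose Q = Q"
    and "trace Q \<noteq> 0"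
    and "msupport \<mu> \<subseteq> quadric b Q T"
  shows "\<exists>\<C> \<subseteq> components (quadric b Q T - singular_points (quadric b Q T)).
           msupport \<mu> = closure (\<Union>\<C>)"
proof (cases "T = 0 \<and> (\<exists>v. v \<noteq> 0 \<and> (\<forall>h. h \<bullet> (Q *v h) = 0 \<longleftrightarrow> v \<bullet> h = 0))
    \<and> (\<exists>z\<in>quadric b Q T. quadric_hgrad b Q T z = 0)")
  case True
  then obtain v z where T: "T = 0" and v: "v \<noteq> 0" "\<And>h. h \<bullet> (Q *v h) = 0 \<longleftrightarrow> v \<bullet> h = 0"
    and z: "z \<in> quadric b Q T" "quadric_hgrad b Q T z = 0" by blast
  \<comment> \<open>In the exceptional case the quadric is a vertical hyperplane, and the arguments apply to its
    linear equation, which has no characteristic points.\<close>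
  have K: "y \<in> quadric b Q T \<longleftrightarrow> v \<bullet> (fst y - fst z) = 0" for y
  proof -
    define w where "w = heis_mult (heis_inv z) y"
    have "y = heis_mult z w" by (simp add: w_def)
    then have "quadric_fun b Q T y = quadric_fun 0 Q T w"
      using z by (simp add: quadric_fun_mult[OF assms(2)] mem_quadric)
    also have "\<dots> = fst w \<bullet> (Q *v fst w)" by (simp add: quadric_fun_def T)
    also have "fst w = fst y - fst z" by (simp add: w_def heis_mult_def heis_inv_def)
    finally show ?thesis unfolding mem_quadric by (simp only: v(2))
  qed
  have "v \<bullet> fst z = 0" using K[of 0] uniformD(3)[OF assms(1)] assms(4) by auto
  then have eq: "quadric b Q T = quadric v 0 0"
    using K by (auto simp: mem_quadric[of _ v] quadric_fun_def inner_diff_right)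
  have hg: "quadric_hgrad v 0 0 y = v" for y :: "'n heis" by (simp add: quadric_hgrad_def)
  have t0: "transpose (0 :: real ^ ('n + 'n) ^ ('n + 'n)) = 0" by (simp add: transpose_def vec_eq_iff)
  have sing: "singular_points (quadric v 0 0) = {y \<in> quadric v 0 0. quadric_hgrad v 0 0 y = (0 :: 'n horiz)}"
    using tangent_group_at_regular_point[OF t0, of _ v 0] v(1)
    unfolding singular_points_def hg by blast
  show ?thesis
    unfolding eq
  proof (rule support_union_of_components[OF assms(1) t0 _ sing])
    show "msupport \<mu> \<subseteq> quadric v 0 0" using assms(4) eq by simp
    show "\<exists>x\<in>msupport \<mu>. koranyi_dist p x \<le> \<rho> \<and> quadric_hgrad v 0 0 x \<noteq> 0"
      if "p \<in> msupport \<mu>" "\<rho> > 0" for p \<rho>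
      using that v(1) by (intro bexI[of _ p]) (simp_all add: hg)
  qed
next
  case False
  have "singular_points (quadric b Q T) = {z \<in> quadric b Q T. quadric_hgrad b Q T z = 0}"
  proof (intro equalityI subsetI)
    fix z assume "z \<in> singular_points (quadric b Q T)"
    then show "z \<in> {z \<in> quadric b Q T. quadric_hgrad b Q T z = 0}"
      using tangent_group_at_regular_point[OF assms(2), of z b T] by (auto simp: singular_points_def)
  next
    fix z assume "z \<in> {z \<in> quadric b Q T. quadric_hgrad b Q T z = 0}"
    then have z: "z \<in> quadric b Q T" "quadric_hgrad b Q T z = 0" by auto
    have "\<not> is_tangent_group (quadric b Q T) z W" for W
    proof
      assume "is_tangent_group (quadric b Q T) z W"
      then obtain v where v: "v \<noteq> 0" "\<And>y. quadric_fun 0 Q T y = 0 \<longleftrightarrow> v \<bullet> fst y = 0"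
        using tangent_group_at_characteristic_point[OF assms(2) z(2)] by blast
      have T: "T = 0" using v(2)[of "(0, 1)"] by (simp add: quadric_fun_def)
      have "h \<bullet> (Q *v h) = 0 \<longleftrightarrow> v \<bullet> h = 0" for h
        using v(2)[of "(h, 0)"] by (simp add: quadric_fun_def)
      then show False using False T v(1) z by blast
    qed
    then show "z \<in> singular_points (quadric b Q T)" using z by (simp add: singular_points_def)
  qed
  then show ?thesis
  proof (rule support_union_of_components[OF assms(1,2,4)])
    fix p \<rho> assume p: "p \<in> msupport \<mu>" and \<rho>: "(\<rho>::real) > 0"
    show "\<exists>x\<in>msupport \<mu>. koranyi_dist p x \<le> \<rho> \<and> quadric_hgrad b Q T x \<noteq> 0"
    proof (cases "quadric_hgrad b Q T p = 0")
      case True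
      have "\<exists>a. Q *v a \<noteq> 0"
      proof (rule ccontr)
        assume "\<not> ?thesis"
        then have "Q = 0" by (simp add: matrix_eq)
        then show False using assms(3) by (simp add: trace_def)
      qed
      then have "T \<noteq> 0 \<or> (\<exists>a. Q *v a \<noteq> 0) \<and> \<not> (\<exists>v. v \<noteq> 0 \<and> (\<forall>h. h \<bullet> (Q *v h) = 0 \<longleftrightarrow> v \<bullet> h = 0))"
        using False True p assms(4) by blast
      then show ?thesis by (rule support_not_characteristic[OF assms(1,2,4) p \<rho>])
    qed (use p \<rho> in \<open>auto intro!: bexI[of _ p]\<close>)
  qed
qed

end
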